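(* Let $b\in\mathbb{R}$, $b>1$, and let $\phi$ be holomorphic in the strip $\{z\in\mathbb{C}: 0<\Re(z)<b\}$, such that for every $y\in\mathbb{R}$ the limit of $\phi(z)$ as $\Re(z)\to 0^+$ along $\Im(z)=y$ exists and is finite. Suppose there are $\alpha\in\mathbb{R}$ with $0\le\alpha<\pi/2$ and $C>0$ such that $|\phi(z)|<Ce^{\alpha|\Im(z)|}$ in the strip. Then for $0<\sigma<b$ and $0<\Re(z)<b$ the expression $$\sum_z\phi=\frac{1}{\Gamma(z)}\int_0^\infty e^{-t}t^{z-1}\left(\int_0^t \frac{e^x}{2\pi i}\left(\int_{\sigma-i\infty}^{\sigma+i\infty}\Gamma(\xi)\phi(\xi)x^{-\xi}\,d\xi\right)dx\right)dt$$ converges and is an indefinite sum of $\phi$ on the strip $0<\Re(z)<b$; more compactly, $\sum_z\phi=\mathcal{Y}_z\int_0^x\mathcal{Y}_x^{-1}\phi$.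
   Context: An indefinite sum of a function $\phi$ holomorphic on an open set $\Omega\subset\mathbb{C}$ is a function $z\mapsto \sum_z\phi$, holomorphic on $\Omega$, such that $\sum_z\phi+\phi(z+1)=\sum_{z+1}\phi$ whenever $z,z+1\in\Omega$. The Twisted Mellin transform of a function $g$ is $\mathcal{Y}_z g=\frac{1}{\Gamma(z)}\int_0^\infty e^{-t}g(t)t^{z-1}\,dt$, and its inverse is $\mathcal{Y}_x^{-1}\phi=\frac{e^x}{2\pi i}\int_{\sigma-i\infty}^{\sigma+i\infty}\Gamma(\xi)\phi(\xi)x^{-\xi}\,d\xi$ with $0<\sigma<b$. The notation $\int_0^x$ denotes the operator sending a function $g$ to its antiderivative $x\mapsto\int_0^x g(u)\,du$. $\Gamma$ is Euler's Gamma function. *)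

theory Defs
  imports "HOL-Complex_Analysis.Complex_Analysis"
begin

definition vstrip :: "real \<Rightarrow> complex set" where
  "vstrip b = {z. 0 < Re z \<and> Re z < b}"

definition is_indefinite_sum ::
  "complex set \<Rightarrow> (complex \<Rightarrow> complex) \<Rightarrow> (complex \<Rightarrow> complex) \<Rightarrow> bool" where
  "is_indefinite_sum \<Omega> \<phi> S \<longleftrightarrow>
     open \<Omega> \<and> \<phi> holomorphic_on \<Omega> \<and> S holomorphic_on \<Omega> \<and>
     (\<forall>z. z \<in> \<Omega> \<and> z + 1 \<in> \<Omega> \<longrightarrow> S z + \<phi> (z + 1) = S (z + 1))"

text \<open>
  The integral of \<open>f\<close> from \<open>\<sigma> - \<i>\<infinity>\<close> to \<open>\<sigma> + \<i>\<infinity>\<close>,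
  along the parametrisation \<open>\<xi> = \<sigma> + \<i> y\<close>, \<open>d\<xi> = \<i> dy\<close>.
\<close>

definition vline_integrable :: "real \<Rightarrow> (complex \<Rightarrow> complex) \<Rightarrow> bool" where
  "vline_integrable \<sigma> f \<longleftrightarrow> integrable lborel (\<lambda>y::real. f (Complex \<sigma> y))"

definition vline_integral :: "real \<Rightarrow> (complex \<Rightarrow> complex) \<Rightarrow> complex" where
  "vline_integral \<sigma> f = \<i> * (LBINT y. f (Complex \<sigma> y))"

definition twisted_mellin :: "(real \<Rightarrow> complex) \<Rightarrow> complex \<Rightarrow> complex" where
  "twisted_mellin g z =
     1 / Gamma z *
     (LBINT t:{0<..}. complex_of_real (exp (- t)) * g t * complex_of_real t powr (z - 1))"

definition twisted_mellin_inv ::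
  "real \<Rightarrow> (complex \<Rightarrow> complex) \<Rightarrow> real \<Rightarrow> complex" where
  "twisted_mellin_inv \<sigma> \<phi> x =
     complex_of_real (exp x) / (2 * complex_of_real pi * \<i>) *
     vline_integral \<sigma> (\<lambda>\<xi>. Gamma \<xi> * \<phi> \<xi> * complex_of_real x powr (- \<xi>))"

definition antideriv0 :: "(real \<Rightarrow> complex) \<Rightarrow> real \<Rightarrow> complex" where
  "antideriv0 g x = (LBINT u=0..x. g u)"

end

theory Submission
  imports Defs "HOL-Real_Asymp.Real_Asymp"
begin

text \<open>
  Put \<open>h = \<Gamma> \<phi>\<close>. Rotating the ray in Euler's integral shows that \<open>\<Gamma>\<close> decays like
  \<open>exp (- \<theta> \<bar>Im z\<bar>)\<close> for every \<open>\<theta> < \<pi>/2\<close>, so \<open>h\<close> decays exponentially on vertical lines and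
  its inverse Mellin transform \<open>G\<close> does not depend on the line of integration. Using all lines
  \<open>Re \<xi> = c\<close> with \<open>0 < c < b\<close> gives \<open>G x = O(x\<^sup>-\<^sup>c)\<close> for all these \<open>c\<close>; hence
  \<open>F t = \<integral>\<^sub>0\<^sup>t e\<^sup>x G x dx\<close> exists (take \<open>c < 1\<close>) and \<open>e\<^sup>-\<^sup>t F t = O(t\<^sup>-\<^sup>c)\<close> at infinity, which makes
  \<open>\<Gamma> z S z = \<integral> e\<^sup>-\<^sup>t t\<^bsup>z-1\<^esup> F t dt\<close> converge locally uniformly. Integration by parts gives
  \<open>\<Gamma> (z+1) S (z+1) = z \<Gamma> z S z + \<integral> t\<^sup>z G t dt\<close>, and the last integral is \<open>h (z+1)\<close> by
  Mellin inversion.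
\<close>

section \<open>Lebesgue integrals depending holomorphically on a parameter\<close>

text \<open>Domination is asked of \<open>f\<close> itself: Cauchy's inequality turns a local
  majorant of \<open>f\<close> into one of its \<open>z\<close>-derivative, hence of the difference
  quotients, and dominated convergence then differentiates under the integral.\<close>

lemma holomorphic_on_lebesgue_integral:
  fixes f :: "complex \<Rightarrow> 'a \<Rightarrow> complex"
  assumes U: "open U"
    and hol: "\<And>t. t \<in> space M \<Longrightarrow> (\<lambda>z. f z t) holomorphic_on U"
    and meas: "\<And>z. z \<in> U \<Longrightarrow> f z \<in> borel_measurable M"
    and dom: "\<And>z. z \<in> U \<Longrightarrow> \<exists>r>0. \<exists>D. integrable M D \<and>
                (\<forall>w\<in>ball z r \<inter> U. \<forall>t\<in>space M. norm (f w t) \<le> D t)"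
  shows "(\<lambda>z. \<integral>t. f z t \<partial>M) holomorphic_on U"
proof -
  have "(\<lambda>z. \<integral>t. f z t \<partial>M) field_differentiable (at z)" if z: "z \<in> U" for z
  proof -
    obtain r0 D where r0: "r0 > 0" and D: "integrable M D"
      and D_bound: "\<And>w t. w \<in> ball z r0 \<inter> U \<Longrightarrow> t \<in> space M \<Longrightarrow> norm (f w t) \<le> D t"
      using dom[OF z] by blast
    obtain r1 where r1: "r1 > 0" "ball z r1 \<subseteq> U"
      using U z by (meson openE)
    \<comment> \<open>Points of the inner disc of radius \<open>r/2\<close> still carry a Cauchy
      circle of radius \<open>r/2\<close> on which both the majorant and holomorphy are
      available.\<close>
    define r where "r = min r0 r1 / 2"
    have r: "r > 0" "r < r0" "r < r1"
      using r0 r1 by (auto simp: r_def)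
    have cball_sub: "cball z r \<subseteq> ball z r0 \<inter> U"
      using r r1 by (auto simp: subset_iff)
    have int: "integrable M (f w)" if "w \<in> cball z r" for w
      using cball_sub that D_bound
      by (intro Bochner_Integration.integrable_bound[OF D] AE_I2 meas) force+
    have deriv_bound: "norm (deriv (\<lambda>w. f w t) v) \<le> D t / (r/2)"
      if v: "v \<in> ball z (r/2)" and t: "t \<in> space M" for v t
    proof -
      have sub: "cball v (r/2) \<subseteq> cball z r"
        using v by (auto simp: subset_iff dist_norm) (smt (verit) norm_triangle_sub dist_norm dist_triangle field_sum_of_halves)
      have "norm ((deriv ^^ 1) (\<lambda>w. f w t) v) \<le> fact 1 * D t / (r/2)^1"
      proof (rule Cauchy_inequality)
        show "(\<lambda>w. f w t) holomorphic_on ball v (r/2)"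
          by (rule holomorphic_on_subset[OF hol[OF t]])
             (use sub cball_sub ball_subset_cball in blast)
        show "continuous_on (cball v (r/2)) (\<lambda>w. f w t)"
          by (rule holomorphic_on_imp_continuous_on, rule holomorphic_on_subset[OF hol[OF t]])
             (use sub cball_sub in blast)
        show "norm (f x t) \<le> D t" if "norm (v - x) = r/2" for x
        proof (rule D_bound[OF _ t])
          have "x \<in> cball v (r/2)" using that by (simp add: dist_norm)
          thus "x \<in> ball z r0 \<inter> U" using sub cball_sub by blast
        qed
      qed (use r in auto)
      thus ?thesis by simp
    qed
    have has_deriv: "((\<lambda>w. f w t) has_field_derivative deriv (\<lambda>w. f w t) v) (at v)"
      if "v \<in> ball z (r/2)" "t \<in> space M" for v t
    proof (rule holomorphic_derivI[OF hol U])
      have "ball z (r/2) \<subseteq> cball z r" using r by auto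
      thus "v \<in> U" using that cball_sub by blast
    qed (use that in auto)
    \<comment> \<open>The mean value inequality on the convex inner disc makes the quotients bounded
      uniformly in \<open>w\<close>; this is the majorant for the limit below.\<close>
    have quot_bound: "norm ((f w t - f z t) / (w - z)) \<le> D t / (r/2)"
      if w: "w \<in> ball z (r/2)" "w \<noteq> z" and t: "t \<in> space M" for w t
    proof -
      have "norm (f w t - f z t) \<le> D t / (r/2) * norm (w - z)"
        by (rule field_differentiable_bound[of "ball z (r/2)" "\<lambda>w. f w t" "deriv (\<lambda>w. f w t)"])
           (use w r t deriv_bound has_deriv in \<open>auto intro: has_field_derivative_at_within\<close>)
      thus ?thesis using w by (simp add: norm_divide field_simps)
    qed
    define d where "d = (\<integral>t. deriv (\<lambda>w. f w t) z \<partial>M)"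
    have "((\<lambda>w. ((\<integral>t. f w t \<partial>M) - (\<integral>t. f z t \<partial>M)) / (w - z)) \<longlongrightarrow> d)
            (at z within ball z (r/2))"
      \<comment> \<open>Sequences, because dominated convergence is applied along a countable index
        set.\<close>
      unfolding tendsto_at_iff_sequentially
    proof (intro allI impI)
      fix X :: "nat \<Rightarrow> complex"
      assume X: "\<forall>i. X i \<in> ball z (r/2) - {z}" and lim: "X \<longlonglongrightarrow> z"
      have X_cball: "X i \<in> cball z r" for i
        using X[rule_format, of i] r by auto
      have z_cball: "z \<in> cball z r" using r by auto
      have tends: "(\<lambda>i. (f (X i) t - f z t) / (X i - z)) \<longlonglongrightarrow> deriv (\<lambda>w. f w t) z"
        if t: "t \<in> space M" for t
      proof -
        have "((\<lambda>w. (f w t - f z t) / (w - z)) \<longlongrightarrow> deriv (\<lambda>w. f w t) z) (at z)"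
          using has_deriv[of z t] t r by (simp add: has_field_derivative_iff)
        thus ?thesis
          using X lim by (auto simp: tendsto_at_iff_sequentially o_def)
      qed
      have "(\<lambda>i. \<integral>t. (f (X i) t - f z t) / (X i - z) \<partial>M) \<longlonglongrightarrow> d"
        unfolding d_def
      proof (rule integral_dominated_convergence[where w = "\<lambda>t. D t / (r/2)"])
        show quot_meas: "(\<lambda>t. (f (X i) t - f z t) / (X i - z)) \<in> borel_measurable M" for i
          using X_cball cball_sub z by (intro borel_measurable_divide borel_measurable_diff meas) auto
        show "(\<lambda>t. deriv (\<lambda>w. f w t) z) \<in> borel_measurable M"
          by (rule borel_measurable_LIMSEQ_metric[OF quot_meas tends])
        show "integrable M (\<lambda>t. D t / (r/2))" using D by simp
      qed (use tends quot_bound X in auto)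
      moreover have "(\<integral>t. (f (X i) t - f z t) / (X i - z) \<partial>M) =
                     ((\<integral>t. f (X i) t \<partial>M) - (\<integral>t. f z t \<partial>M)) / (X i - z)" for i
        using int[OF X_cball[of i]] int[OF z_cball] by simp
      ultimately show "((\<lambda>w. ((\<integral>t. f w t \<partial>M) - (\<integral>t. f z t \<partial>M)) / (w - z)) \<circ> X) \<longlonglongrightarrow> d"
        unfolding o_def by (simp only:)
    qed
    moreover have "at z within ball z (r/2) = at z"
      using r by (intro at_within_open) auto
    ultimately show ?thesis
      by (auto simp: field_differentiable_def has_field_derivative_iff)
  qed
  thus ?thesis
    by (auto simp: holomorphic_on_def intro: field_differentiable_at_within)
qed

lemma integrable_exp_minus_abs:
  fixes e :: real
  assumes "e > 0"
  shows "integrable lborel (\<lambda>y::real. exp (- e * \<bar>y\<bar>))"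
proof -
  have "(\<lambda>y. exp (- e * y)) absolutely_integrable_on {0..}"
    using integrable_on_exp_minus_to_infinity[of e 0] assms
    by (intro nonnegative_absolutely_integrable_1) auto
  hence pos: "integrable lborel (\<lambda>y. indicator {0..} y *\<^sub>R exp (- e * y))"
    unfolding set_integrable_def by (subst (asm) integrable_completion) simp_all
  hence neg: "integrable lborel (\<lambda>y. indicator {0..} (-y) *\<^sub>R exp (- e * (-y)))"
    using lborel_integrable_real_affine[OF pos, of "-1" 0] by simp
  show ?thesis
    by (rule Bochner_Integration.integrable_bound[OF Bochner_Integration.integrable_add[OF pos neg]])
       (auto simp: indicator_def abs_if)
qed

subsection \<open>Exponential decay of the Gamma function\<close>

text \<open>Absolute integrability refers to the completed Lebesgue measure; Borel measurability of
  the cut-off integrand brings it down to \<open>lborel\<close>.\<close>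

lemma set_integrable_Gamma_integral:
  assumes "Re s > 0" "a > 0"
  shows "set_integrable lborel {0<..} (\<lambda>t. complex_of_real t powr (s - 1) / of_real (exp (a * t)))"
proof -
  have "(\<lambda>t. indicat_real {0<..} t *\<^sub>R (complex_of_real t powr (s - 1) / of_real (exp (a * t)))) \<in> borel_measurable borel"
    by (intro borel_measurable_continuous_on_indicator continuous_intros) auto
  thus ?thesis
    using absolutely_integrable_Gamma_integral[OF assms]
    unfolding set_integrable_def by (subst (asm) integrable_completion) simp_all
qed

text \<open>Substitution \<open>t -> a * t\<close> in Euler's integral. It supplies the values on
  the positive axis from which the formula is continued to complex scale factors.\<close>

lemma Gamma_eq_scaled_integral_real:
  assumes s: "Re s > 0" and a: "a > 0"
  shows "(LBINT t:{0<..}. of_real t powr (s - 1) * exp (- (of_real a * of_real t))) =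
         Gamma s / of_real a powr s"
proof -
  let ?f = "\<lambda>t::real. indicat_real {0<..} t *\<^sub>R (complex_of_real t powr (s - 1) / of_real (exp t))"
  have exp_eq: "complex_of_real (exp (t * a)) = exp (of_real t * of_real a)" for t
    by (metis exp_of_real of_real_mult)
  have int: "set_integrable lborel {0<..} (\<lambda>t. complex_of_real t powr (s - 1) / of_real (exp t))"
    using set_integrable_Gamma_integral[OF s, of 1] by simp
  have "integral {0<..} (\<lambda>t. complex_of_real t powr (s - 1) / of_real (exp t)) = 
        integral {0..} (\<lambda>t. complex_of_real t powr (s - 1) / of_real (exp t))"
    by (rule integral_subset_negligible) (auto intro: negligible_subset[of "{0}"])
  hence "Gamma s = (\<integral>t. ?f t \<partial>lborel)"
    using set_borel_integral_eq_integral(2)[OF int] integral_unique[OF Gamma_integral_complex[OF s]]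
    by (simp add: set_lebesgue_integral_def)
  also have "\<dots> = \<bar>a\<bar> *\<^sub>R (\<integral>t. ?f (0 + a * t) \<partial>lborel)"
    by (rule lborel_integral_real_affine) (use a in auto)
  also have "(\<lambda>t. ?f (0 + a * t)) = (\<lambda>t. of_real a powr (s - 1) *
       (indicat_real {0<..} t *\<^sub>R (of_real t powr (s - 1) * exp (- (of_real a * of_real t)))))"
    using a by (auto simp: fun_eq_iff indicator_def zero_less_mult_iff powr_times_real exp_minus exp_eq field_simps)
  also have "(\<integral>t. of_real a powr (s - 1) *
       (indicat_real {0<..} t *\<^sub>R (of_real t powr (s - 1) * exp (- (of_real a * of_real t)))) \<partial>lborel)
     = of_real a powr (s - 1) * (LBINT t:{0<..}. of_real t powr (s - 1) * exp (- (of_real a * of_real t)))"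
    unfolding set_lebesgue_integral_def by (rule integral_mult_right_zero)
  finally show ?thesis
    using a by (simp add: powr_diff scaleR_conv_of_real field_simps)
qed

text \<open>The left-hand side is holomorphic in \<open>u\<close> on the right half-plane and equals
  the constant \<open>Gamma s\<close> for positive real \<open>u\<close>, so the identity theorem
  does the work of rotating a contour.\<close>

lemma Gamma_eq_scaled_integral:
  assumes s: "Re s > 0" and u: "Re u > 0"
  shows "u powr s * (LBINT t:{0<..}. of_real t powr (s - 1) * exp (- (u * of_real t))) = Gamma s"
proof -
  define J where "J = (\<lambda>u. LBINT t:{0<..}. of_real t powr (s - 1) * exp (- (u * of_real t)))"
  let ?H = "{u. Re u > 0}"
  have "J holomorphic_on ?H"
    unfolding J_def set_lebesgue_integral_def
  proof (rule holomorphic_on_lebesgue_integral)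
    show "open ?H" by (rule open_halfspace_Re_gt)
    show "(\<lambda>u. indicat_real {0<..} t *\<^sub>R (of_real t powr (s - 1) * exp (- (u * of_real t)))) holomorphic_on ?H" for t
      unfolding scaleR_conv_of_real by (intro holomorphic_intros)
    show "(\<lambda>t. indicat_real {0<..} t *\<^sub>R (of_real t powr (s - 1) * exp (- (u * of_real t)))) \<in> borel_measurable lborel" for u
      unfolding measurable_lborel2
      by (intro borel_measurable_continuous_on_indicator continuous_intros) auto
    fix v :: complex assume v: "v \<in> ?H"
    \<comment> \<open>Within distance \<open>Re v / 2\<close> of \<open>v\<close> the decay rate
      \<open>Re w\<close> stays above \<open>Re v / 2\<close>, so this one integrand dominates all
      the others.\<close>
    let ?D = "\<lambda>t. norm (indicat_real {0<..} t *\<^sub>R (complex_of_real t powr (s - 1) / of_real (exp (Re v / 2 * t))))"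
    have D: "integrable lborel ?D"
      using set_integrable_Gamma_integral[OF s, of "Re v / 2"] v
      unfolding set_integrable_def by (intro integrable_norm) auto
    have bound: "norm (indicat_real {0<..} t *\<^sub>R (of_real t powr (s - 1) * exp (- (w * of_real t)))) \<le> ?D t"
      if w: "w \<in> ball v (Re v / 2) \<inter> ?H" for w t
    proof (cases "t > 0")
      case True
      have "\<bar>Re (v - w)\<bar> < Re v / 2"
        using w abs_Re_le_cmod[of "v - w"] by (simp add: dist_norm)
      hence "Re v / 2 \<le> Re w" by (simp add: abs_if split: if_splits)
      hence "exp (- (Re w * t)) \<le> exp (- (Re v / 2 * t))"
        using True by simp
      thus ?thesis using True
        by (simp add: norm_mult norm_divide exp_minus[of "Re v * t / 2"] flip: divide_inverse)
           (simp add: exp_minus field_simps mult_left_mono)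
    qed auto
    show "\<exists>r>0. \<exists>D. integrable lborel D \<and>
            (\<forall>w\<in>ball v r \<inter> ?H. \<forall>t\<in>space lborel. norm (indicat_real {0<..} t *\<^sub>R (of_real t powr (s - 1) * exp (- (w * of_real t)))) \<le> D t)"
      using D bound v by (intro exI[of _ "Re v / 2"] exI[of _ ?D] conjI ballI) auto
  qed
  hence hol: "(\<lambda>u. u powr s * J u - Gamma s) holomorphic_on ?H"
    by (intro holomorphic_intros) (auto simp: complex_nonpos_Reals_iff)
  have "u powr s * J u - Gamma s = 0"
  proof (rule analytic_continuation[OF hol])
    show "open ?H" by (rule open_halfspace_Re_gt)
    show "connected ?H" by (intro convex_connected convex_halfspace_Re_gt)
    show "of_real ` {0<..} \<subseteq> ?H" by auto
    show "1 \<in> ?H" by simp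
    show "(1::complex) islimpt of_real ` {0<..}"
      unfolding islimpt_approachable
    proof (intro allI impI)
      fix e :: real assume "e > 0"
      thus "\<exists>x'\<in>complex_of_real ` {0<..}. x' \<noteq> 1 \<and> dist x' 1 < e"
        by (intro bexI[of _ "of_real (1 + e/2)"] imageI) (auto simp: dist_norm)
    qed
    show "z powr s * J z - Gamma s = 0" if z: "z \<in> of_real ` {0<..}" for z
    proof -
      obtain a where a: "a > 0" "z = of_real a" using z by auto
      show ?thesis
        using Gamma_eq_scaled_integral_real[OF s a(1)] a by (simp add: J_def)
    qed
    show "u \<in> ?H" using u by simp
  qed
  thus ?thesis by (simp add: J_def)
qed

text \<open>Rotating the ray of integration in Euler's integral by the angle \<open>\<theta>\<close> trades
  the factor \<open>cos \<theta>\<close> in the exponential for decay in the imaginary direction.\<close>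

lemma norm_Gamma_le_exp:
  assumes s: "Re s > 0" and \<theta>: "0 \<le> \<theta>" "\<theta> < pi / 2"
  shows "norm (Gamma s) \<le> Gamma (Re s) / cos \<theta> powr Re s * exp (- \<theta> * \<bar>Im s\<bar>)"
proof -
  \<comment> \<open>The ray is turned in the direction given by the sign of \<open>Im s\<close>, so
    that the modulus \<open>exp (- \<eta> * Im s)\<close> of \<open>u powr s\<close> becomes
    \<open>exp (- \<theta> * \<bar>Im s\<bar>)\<close>.\<close>
  define \<eta> where "\<eta> = (if Im s \<ge> 0 then \<theta> else - \<theta>)"
  have cos_pos: "cos \<theta> > 0" using \<theta> by (intro cos_gt_zero_pi) auto
  have cos_\<eta>: "cos \<eta> = cos \<theta>" by (simp add: \<eta>_def)
  define u where "u = exp (\<i> * of_real \<eta>)"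
  have Re_u: "Re u = cos \<theta>" by (simp add: u_def cos_\<eta> Re_exp)
  have Ln_u: "Ln u = \<i> * of_real \<eta>"
    unfolding u_def by (rule Ln_exp) (use \<theta> pi_gt_zero in \<open>auto simp: \<eta>_def\<close>)
  have "norm (u powr s) = exp (Re (s * Ln u))"
    by (simp add: powr_def u_def)
  hence "norm (u powr s) = exp (- \<theta> * \<bar>Im s\<bar>)"
    by (simp add: Ln_u \<eta>_def)
  \<comment> \<open>The modulus of the integrand is again an Euler integrand, with
    \<open>Re s\<close> for \<open>s\<close> and \<open>Re u = cos \<theta>\<close> for
    \<open>u\<close>, so the real case evaluates its integral exactly.\<close>
  moreover have "norm (LBINT t:{0<..}. of_real t powr (s - 1) * exp (- (u * of_real t)))
        \<le> Gamma (Re s) / cos \<theta> powr Re s"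
  proof -
    let ?f = "\<lambda>t. indicat_real {0<..} t *\<^sub>R (complex_of_real t powr (s - 1) * exp (- (u * of_real t)))"
    let ?g = "\<lambda>t. indicat_real {0<..} t *\<^sub>R (complex_of_real t powr (of_real (Re s) - 1) * exp (- (of_real (cos \<theta>) * of_real t)))"
    have norm_eq: "of_real (norm (?f t)) = ?g t" for t
    proof (cases "t > 0")
      case True
      have "complex_of_real t powr (of_real (Re s) - 1) = of_real (t powr (Re s - 1))"
        using True powr_of_real[of t "Re s - 1"] by simp
      moreover have "exp (- (of_real (cos \<theta>) * complex_of_real t)) = of_real (exp (- (cos \<theta> * t)))"
        by (metis exp_of_real of_real_minus of_real_mult)
      ultimately show ?thesis
        using True by (simp add: norm_mult Re_u norm_powr_real_powr)
    qed auto
    have "norm (LBINT t. ?f t) \<le> (LBINT t. norm (?f t))"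
      by (rule integral_norm_bound)
    also have "(LBINT t. norm (?f t)) = Gamma (Re s) / cos \<theta> powr Re s"
    proof -
      have "complex_of_real (LBINT t. norm (?f t)) = (LBINT t. of_real (norm (?f t)))"
        by (rule integral_complex_of_real[symmetric])
      also have "\<dots> = (LBINT t. ?g t)"
        unfolding norm_eq ..
      also have "\<dots> = Gamma (of_real (Re s)) / of_real (cos \<theta>) powr of_real (Re s)"
        using Gamma_eq_scaled_integral_real[of "of_real (Re s)" "cos \<theta>"] s cos_pos
        unfolding set_lebesgue_integral_def by simp
      also have "\<dots> = of_real (Gamma (Re s) / cos \<theta> powr Re s)"
        using cos_pos Gamma_complex_of_real[of "Re s"] powr_of_real[of "cos \<theta>" "Re s"] by simp
      finally show ?thesis
        unfolding of_real_eq_iff .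
    qed
    finally show ?thesis
      unfolding set_lebesgue_integral_def .
  qed
  moreover have "norm (Gamma s) = norm (LBINT t:{0<..}. of_real t powr (s - 1) * exp (- (u * of_real t))) * norm (u powr s)"
    unfolding norm_mult[symmetric]
    by (subst mult.commute, subst Gamma_eq_scaled_integral) (use s cos_pos Re_u in auto)
  ultimately show ?thesis
    by (simp only:) (intro mult_right_mono exp_ge_zero)
qed

subsection \<open>Integrals along vertical lines and of powers\<close>

text \<open>Cut off at height \<open>R\<close>, the two lines are the vertical sides of a rectangle,
  and each horizontal side contributes at most \<open>(c2 - c1) * \<delta> R\<close>. The value
  \<open>I\<close> is \<open>0\<close> when the line is merely moved and a residue term when a pole
  is crossed; \<open>T\<close> lets the rectangles start above that pole.\<close>

lemma vline_integral_diff: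
  assumes c: "c1 < c2"
    and int: "vline_integrable c1 q" "vline_integrable c2 q"
    and rect: "\<And>R. R > T \<Longrightarrow> (q has_contour_integral I) (rectpath (Complex c1 (-R)) (Complex c2 R))"
    and bound: "\<And>z. c1 \<le> Re z \<Longrightarrow> Re z \<le> c2 \<Longrightarrow> \<bar>Im z\<bar> > T \<Longrightarrow> norm (q z) \<le> \<delta> \<bar>Im z\<bar>"
    and \<delta>: "(\<delta> \<longlongrightarrow> 0) at_top"
  shows "vline_integral c2 q - vline_integral c1 q = I"
proof -
  define V where "V = (\<lambda>c R. integral {-R..R} (\<lambda>y. q (Complex c y)))"
  have V_lim: "(V c \<longlongrightarrow> (LBINT y. q (Complex c y))) at_top" if c: "vline_integrable c q" for c
  proof -
    have int_c: "integrable lborel (\<lambda>y. q (Complex c y))"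
      using c by (simp add: vline_integrable_def)
    have "((\<lambda>R. \<integral>y. indicator {-R..R} y *\<^sub>R q (Complex c y) \<partial>lborel) \<longlongrightarrow> (LBINT y. q (Complex c y))) at_top"
    proof (rule integral_dominated_convergence_at_top[where w = "\<lambda>y. norm (q (Complex c y))"])
      show "AE y in lborel. ((\<lambda>R. indicator {-R..R} y *\<^sub>R q (Complex c y)) \<longlongrightarrow> q (Complex c y)) at_top"
      proof (rule AE_I2)
        fix y :: real
        have "eventually (\<lambda>R. indicator {-R..R} y *\<^sub>R q (Complex c y) = q (Complex c y)) at_top"
          using eventually_ge_at_top[of "\<bar>y\<bar>"] by eventually_elim (auto simp: indicator_def)
        thus "((\<lambda>R. indicator {-R..R} y *\<^sub>R q (Complex c y)) \<longlongrightarrow> q (Complex c y)) at_top"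
          by (rule tendsto_eventually)
      qed
    qed (use int_c in \<open>auto simp: indicator_def\<close>)
    moreover have "(\<integral>y. indicator {-R..R} y *\<^sub>R q (Complex c y) \<partial>lborel) = V c R" for R
    proof -
      have "set_integrable lborel {-R..R} (\<lambda>y. q (Complex c y))"
        unfolding set_integrable_def by (rule integrable_mult_indicator[OF _ int_c]) auto
      from set_borel_integral_eq_integral(2)[OF this] show ?thesis
        by (simp add: V_def set_lebesgue_integral_def)
    qed
    ultimately show ?thesis by simp
  qed
  have "eventually (\<lambda>R. norm (\<i> * V c2 R - \<i> * V c1 R - I) \<le> 2 * ((c2 - c1) * \<delta> R)) at_top"
    \<comment> \<open>\<open>R > T\<close> makes the hypotheses on \<open>q\<close> available, and
      \<open>R > 0\<close> orients the vertical sides.\<close>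
    using eventually_gt_at_top[of "max T 0"]
  proof eventually_elim
    fix R assume R: "R > max T 0"
    define a1 a2 a3 a4 where a_defs: "a1 = Complex c1 (-R)" "a2 = Complex c2 (-R)" "a3 = Complex c2 R" "a4 = Complex c1 R"
    have hci: "(q has_contour_integral I) (linepath a1 a2 +++ linepath a2 a3 +++ linepath a3 a4 +++ linepath a4 a1)"
      using rect[of R] R by (simp add: rectpath_def a_defs Let_def)
    note ci = has_contour_integral_integrable[OF hci]
    have ci1: "q contour_integrable_on linepath a1 a2" 
      and ci234: "q contour_integrable_on (linepath a2 a3 +++ linepath a3 a4 +++ linepath a4 a1)"
      using ci by (auto dest: contour_integrable_joinD1 contour_integrable_joinD2)
    have ci2: "q contour_integrable_on linepath a2 a3" 
      and ci34: "q contour_integrable_on (linepath a3 a4 +++ linepath a4 a1)"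
      using ci234 by (auto dest: contour_integrable_joinD1 contour_integrable_joinD2)
    have ci3: "q contour_integrable_on linepath a3 a4" and ci4: "q contour_integrable_on linepath a4 a1"
      using ci34 by (auto dest: contour_integrable_joinD1 contour_integrable_joinD2)
    have "I = contour_integral (linepath a1 a2) q + (contour_integral (linepath a2 a3) q +
            (contour_integral (linepath a3 a4) q + contour_integral (linepath a4 a1) q))"
      using contour_integral_unique[OF hci] ci1 ci2 ci3 ci4 by simp
    moreover have "contour_integral (linepath a2 a3) q = \<i> * V c2 R"
      unfolding V_def by (rule contour_integral_linepath_same_Re) (use R in \<open>auto simp: a_defs\<close>)
    \<comment> \<open>The left side is traversed downwards, hence the minus sign.\<close>
    moreover have "contour_integral (linepath a4 a1) q = - (\<i> * V c1 R)"
    proof -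
      have "contour_integral (linepath a4 a1) q = - contour_integral (linepath a1 a4) q"
        using contour_integral_reversepath[of "linepath a1 a4" q] by simp
      also have "contour_integral (linepath a1 a4) q = \<i> * V c1 R"
        unfolding V_def by (rule contour_integral_linepath_same_Re) (use R in \<open>auto simp: a_defs\<close>)
      finally show ?thesis .
    qed
    ultimately have I_eq: "\<i> * V c2 R - \<i> * V c1 R - I =
        - (contour_integral (linepath a1 a2) q + contour_integral (linepath a3 a4) q)"
      by (simp add: algebra_simps)
    have "\<delta> R \<ge> 0"
      using bound[of "Complex c1 R"] c R by (auto intro: order_trans[OF norm_ge_zero])
    have "norm (contour_integral (linepath a1 a2) q) \<le> \<delta> R * norm (a2 - a1)"
    proof (rule contour_integral_bound_linepath[OF ci1 \<open>\<delta> R \<ge> 0\<close>])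
      fix z assume z: "z \<in> closed_segment a1 a2"
      hence "Im z = - R" "c1 \<le> Re z" "Re z \<le> c2"
        using c by (auto simp: a_defs closed_segment_same_Im closed_segment_eq_real_ivl)
      thus "norm (q z) \<le> \<delta> R" using bound[of z] R by simp
    qed
    moreover have "norm (contour_integral (linepath a3 a4) q) \<le> \<delta> R * norm (a4 - a3)"
    proof (rule contour_integral_bound_linepath[OF ci3 \<open>\<delta> R \<ge> 0\<close>])
      fix z assume z: "z \<in> closed_segment a3 a4"
      hence "Im z = R" "c1 \<le> Re z" "Re z \<le> c2"
        using c by (auto simp: a_defs closed_segment_same_Im closed_segment_eq_real_ivl)
      thus "norm (q z) \<le> \<delta> R" using bound[of z] R by simp
    qed
    moreover have "norm (a2 - a1) = c2 - c1" "norm (a4 - a3) = c2 - c1"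
      using c by (auto simp: a_defs cmod_def)
    ultimately show "norm (\<i> * V c2 R - \<i> * V c1 R - I) \<le> 2 * ((c2 - c1) * \<delta> R)"
      unfolding I_eq norm_minus_cancel
      by (intro order_trans[OF norm_triangle_ineq]) (simp add: algebra_simps)
  qed
  moreover have "((\<lambda>R. 2 * ((c2 - c1) * \<delta> R)) \<longlongrightarrow> 0) at_top"
    by (intro tendsto_mult_right_zero \<delta>)
  ultimately have "((\<lambda>R. \<i> * V c2 R - \<i> * V c1 R - I) \<longlongrightarrow> 0) at_top"
    by (rule Lim_null_comparison)
  moreover have "((\<lambda>R. \<i> * V c2 R - \<i> * V c1 R - I) \<longlongrightarrow> vline_integral c2 q - vline_integral c1 q - I) at_top"
    unfolding vline_integral_def by (intro tendsto_intros V_lim int)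
  ultimately have "vline_integral c2 q - vline_integral c1 q - I = 0"
    using tendsto_unique[OF trivial_limit_at_top_linorder] by blast
  thus ?thesis by simp
qed

lemma set_integrable_lborel_nonneg:
  fixes f :: "real \<Rightarrow> real"
  assumes "f integrable_on A" "\<And>x. x \<in> A \<Longrightarrow> f x \<ge> 0"
    "(\<lambda>x. indicator A x *\<^sub>R f x) \<in> borel_measurable borel"
  shows "set_integrable lborel A f"
proof -
  have "f absolutely_integrable_on A"
    by (intro nonnegative_absolutely_integrable_1 assms)
  thus ?thesis
    using assms(3) unfolding set_integrable_def by (subst (asm) integrable_completion) simp_all
qed

lemma set_integrable_powr_from_0:
  assumes "a > (-1::real)" "u \<ge> 0"
  shows "set_integrable lborel {0<..u} (\<lambda>t. t powr a)"
  using assms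
  by (intro set_integrable_lborel_nonneg integrable_on_powr_from_0'
            borel_measurable_continuous_on_indicator continuous_intros) auto

lemma set_integrable_powr_1_inf:
  assumes "a < (-1::real)"
  shows "set_integrable lborel {1<..} (\<lambda>t. t powr a)"
proof (rule set_integrable_subset)
  show "set_integrable lborel {1..} (\<lambda>t. t powr a)"
    using has_integral_powr_to_inf[of a 1] assms
    by (intro set_integrable_lborel_nonneg borel_measurable_continuous_on_indicator continuous_intros)
       (auto simp: integrable_on_def)
qed auto

lemma tendsto_powr_at_right_0_complex:
  assumes "Re s > 0"
  shows "((\<lambda>t. complex_of_real t powr s) \<longlongrightarrow> 0) (at_right 0)"
proof (rule Lim_null_comparison)
  show "eventually (\<lambda>t. norm (complex_of_real t powr s) \<le> t powr Re s) (at_right 0)"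
    using eventually_at_right_less[of 0] by eventually_elim (simp add: norm_powr_real_powr)
  show "((\<lambda>t. t powr Re s) \<longlongrightarrow> 0) (at_right 0)"
    using assms by real_asymp
qed

lemma tendsto_powr_at_top_complex:
  assumes "Re s < 0"
  shows "((\<lambda>t. complex_of_real t powr s) \<longlongrightarrow> 0) at_top"
proof (rule Lim_null_comparison)
  show "eventually (\<lambda>t. norm (complex_of_real t powr s) \<le> t powr Re s) at_top"
    using eventually_gt_at_top[of 0] by eventually_elim (simp add: norm_powr_real_powr)
  show "((\<lambda>t. t powr Re s) \<longlongrightarrow> 0) at_top"
    using assms by real_asymp
qed

lemma has_vector_derivative_of_real_powr:
  assumes "t > 0"
  shows "((\<lambda>t. complex_of_real t powr s) has_vector_derivative (s * of_real t powr (s - 1))) (at t)"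
proof -
  have "((\<lambda>z. z powr s) has_field_derivative (s * of_real t powr (s - 1))) (at (of_real t))"
    using assms by (intro has_field_derivative_powr) auto
  thus ?thesis by (rule has_vector_derivative_real_field)
qed

lemma isCont_of_real_powr:
  "t > 0 \<Longrightarrow> isCont (\<lambda>t. complex_of_real t powr s) t"
  by (intro has_vector_derivative_continuous[OF has_vector_derivative_of_real_powr])

lemma set_integrable_powr_bound:
  assumes "set_integrable lborel A (\<lambda>t. t powr Re s)" "A \<subseteq> {0<..}" "A \<in> sets borel"
  shows "set_integrable lborel A (\<lambda>t. complex_of_real t powr s)"
proof -
  have "set_borel_measurable lborel {0<..} (\<lambda>t. complex_of_real t powr s)"
    unfolding set_borel_measurable_def measurable_lborel2
    by (intro borel_measurable_continuous_on_indicator continuous_intros) auto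
  hence "set_borel_measurable lborel A (\<lambda>t. complex_of_real t powr s)"
    by (rule set_borel_measurable_subset) (use assms in auto)
  thus ?thesis
    by (rule set_integrable_bound[OF assms(1)])
       (use assms(2) in \<open>auto simp: norm_powr_real_powr subset_iff intro!: AE_I2\<close>)
qed

text \<open>The antiderivative \<open>t powr s / s\<close> vanishes at \<open>0\<close>. For
  \<open>s = w - \<xi>\<close> this yields the Cauchy kernel at points \<open>\<xi>\<close> to the
  left of \<open>w\<close>.\<close>

lemma set_integral_powr_0_1:
  assumes "Re s > 0"
  shows "(LBINT t:{0<..1}. complex_of_real t powr (s - 1)) = 1 / s"
proof -
  have s: "s \<noteq> 0" using assms by auto
  have "(LBINT t=ereal 0..ereal 1. complex_of_real t powr (s - 1)) = 1 / s - 0"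
  proof (rule interval_integral_FTC_integrable[where F = "\<lambda>t. of_real t powr s / s"])
    fix t :: real assume "ereal 0 < ereal t" "ereal t < ereal 1"
    hence t: "t > 0" by simp
    show "((\<lambda>t. of_real t powr s / s) has_vector_derivative complex_of_real t powr (s - 1)) (at t)"
      using has_vector_derivative_divide[OF has_vector_derivative_of_real_powr[OF t, of s], of s] s by simp
    show "isCont (\<lambda>t. complex_of_real t powr (s - 1)) t"
      by (rule isCont_of_real_powr[OF t])
  next
    have "set_integrable lborel {0<..1} (\<lambda>t. complex_of_real t powr (s - 1))"
      using assms by (intro set_integrable_powr_bound set_integrable_powr_from_0) auto
    thus "set_integrable lborel (einterval (ereal 0) (ereal 1)) (\<lambda>t. complex_of_real t powr (s - 1))"
      by (rule set_integrable_subset) auto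
    show "(((\<lambda>t. of_real t powr s / s) \<circ> real_of_ereal) \<longlongrightarrow> 0) (at_right (ereal 0))"
      unfolding ereal_tendsto_simps
      by (rule tendsto_divide_zero) (rule tendsto_powr_at_right_0_complex[OF assms])
    have "((\<lambda>t. of_real t powr s / s) \<longlongrightarrow> of_real 1 powr s / s) (at_left 1)"
      by (rule tendsto_mono[OF at_le[OF subset_UNIV]])
         (intro tendsto_divide tendsto_const isCont_of_real_powr[unfolded isCont_def] s, simp)
    thus "(((\<lambda>t. of_real t powr s / s) \<circ> real_of_ereal) \<longlongrightarrow> 1 / s) (at_left (ereal 1))"
      unfolding ereal_tendsto_simps by simp
  qed simp
  thus ?thesis by (simp add: interval_integral_Ioc)
qed

text \<open>Here the antiderivative vanishes at infinity and only the lower endpoint counts, whence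
  the opposite sign; with \<open>s = w - \<xi>\<close> it serves points \<open>\<xi>\<close> to the
  right of \<open>w\<close>.\<close>

lemma set_integral_powr_1_inf:
  assumes "Re s < 0"
  shows "(LBINT t:{1<..}. complex_of_real t powr (s - 1)) = - 1 / s"
proof -
  have s: "s \<noteq> 0" using assms by auto
  have "(LBINT t=ereal 1..\<infinity>. complex_of_real t powr (s - 1)) = 0 - 1 / s"
  proof (rule interval_integral_FTC_integrable[where F = "\<lambda>t. of_real t powr s / s"])
    fix t :: real assume "ereal 1 < ereal t"
    hence t: "t > 0" by simp
    show "((\<lambda>t. of_real t powr s / s) has_vector_derivative complex_of_real t powr (s - 1)) (at t)"
      using has_vector_derivative_divide[OF has_vector_derivative_of_real_powr[OF t, of s], of s] s by simp
    show "isCont (\<lambda>t. complex_of_real t powr (s - 1)) t"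
      by (rule isCont_of_real_powr[OF t])
  next
    have "set_integrable lborel {1<..} (\<lambda>t. complex_of_real t powr (s - 1))"
      using assms by (intro set_integrable_powr_bound set_integrable_powr_1_inf) auto
    thus "set_integrable lborel (einterval (ereal 1) \<infinity>) (\<lambda>t. complex_of_real t powr (s - 1))"
      by simp
    show "(((\<lambda>t. of_real t powr s / s) \<circ> real_of_ereal) \<longlongrightarrow> 0) (at_left \<infinity>)"
      unfolding ereal_tendsto_simps
      by (rule tendsto_divide_zero) (rule tendsto_powr_at_top_complex[OF assms])
    have "((\<lambda>t. of_real t powr s / s) \<longlongrightarrow> of_real 1 powr s / s) (at_right 1)"
      by (rule tendsto_mono[OF at_le[OF subset_UNIV]])
         (intro tendsto_divide tendsto_const isCont_of_real_powr[unfolded isCont_def] s, simp)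
    thus "(((\<lambda>t. of_real t powr s / s) \<circ> real_of_ereal) \<longlongrightarrow> 1 / s) (at_right (ereal 1))"
      unfolding ereal_tendsto_simps by simp
  qed simp
  thus ?thesis by (simp add: interval_lebesgue_integral_le_eq)
qed

subsection \<open>The inverse Mellin transform on a strip\<close>

lemma open_vstrip: "open (vstrip b)"
  unfolding vstrip_def by (intro open_Collect_conj open_halfspace_Re_gt open_halfspace_Re_lt)

text \<open>Isolates what is used of \<open>Gamma \<xi> * \<phi> \<xi>\<close>. The rate
  \<open>e\<close> is uniform, but \<open>K\<close> may depend on the closed substrip, since
  \<open>Gamma\<close> is unbounded near its pole at \<open>0\<close>.\<close>

locale strip_decay =
  fixes h :: "complex \<Rightarrow> complex" and b e :: real
  assumes e: "e > 0"
    and hol: "h holomorphic_on vstrip b"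
    and decay: "\<And>c1 c2. 0 < c1 \<Longrightarrow> c2 < b \<Longrightarrow>
      \<exists>K. \<forall>z. c1 \<le> Re z \<and> Re z \<le> c2 \<longrightarrow> norm (h z) \<le> K * exp (- e * \<bar>Im z\<bar>)"
begin

text \<open>The classical inverse Mellin transform of \<open>h\<close>, that is, the twisted one
  without \<open>exp x\<close>. The abscissa \<open>c\<close> remains a parameter because different
  estimates choose different lines.\<close>

definition mellin_inv :: "real \<Rightarrow> real \<Rightarrow> complex" where
  "mellin_inv c x = 1 / (2 * of_real pi * \<i>) * vline_integral c (\<lambda>\<xi>. h \<xi> * of_real x powr (- \<xi>))"

definition line_norm :: "real \<Rightarrow> real" where
  "line_norm c = (LBINT y. norm (h (Complex c y))) / (2 * pi)"

lemma line_norm_nonneg: "line_norm c \<ge> 0"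
  by (simp add: line_norm_def)

lemma continuous_on_line:
  assumes "0 < c" "c < b"
  shows "continuous_on UNIV (\<lambda>y. h (Complex c y))"
  using assms
  by (intro continuous_on_compose2[OF holomorphic_on_imp_continuous_on[OF hol]])
     (auto simp: vstrip_def Complex_eq intro!: continuous_intros)

lemma measurable_line [measurable]:
  assumes "0 < c" "c < b"
  shows "(\<lambda>y. h (Complex c y)) \<in> borel_measurable borel"
  by (intro borel_measurable_continuous_onI continuous_on_line assms)

lemma integrable_line:
  assumes "0 < c" "c < b"
  shows "integrable lborel (\<lambda>y. h (Complex c y))"
proof -
  obtain K where "\<And>z. c \<le> Re z \<and> Re z \<le> c \<Longrightarrow> norm (h z) \<le> K * exp (- e * \<bar>Im z\<bar>)"
    using decay[OF assms] by blast
  hence K: "norm (h (Complex c y)) \<le> K * exp (- e * \<bar>y\<bar>)" for y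
    by (metis complex.sel order.refl)
  have "integrable lborel (\<lambda>y. K * exp (- e * \<bar>y\<bar>))"
    by (intro integrable_mult_right integrable_exp_minus_abs e)
  thus ?thesis
    by (rule Bochner_Integration.integrable_bound)
       (use assms in \<open>auto intro!: order_trans[OF K]\<close>)
qed

text \<open>Serves two bounded kernels: the power \<open>x powr (- \<xi>)\<close> and the Cauchy
  kernel \<open>1 / (\<xi> - w)\<close>.\<close>

lemma integrable_line_mult:
  assumes c: "0 < c" "c < b" and k: "continuous_on UNIV (\<lambda>y. k (Complex c y))"
    and B: "\<And>y. norm (k (Complex c y)) \<le> B"
  shows "vline_integrable c (\<lambda>\<xi>. h \<xi> * k \<xi>)"
  unfolding vline_integrable_def
proof (rule Bochner_Integration.integrable_bound)
  show "integrable lborel (\<lambda>y. B * norm (h (Complex c y)))"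
    by (intro integrable_mult_right integrable_norm integrable_line c)
  show "(\<lambda>y. h (Complex c y) * k (Complex c y)) \<in> borel_measurable lborel"
    unfolding measurable_lborel2
    by (intro borel_measurable_continuous_onI continuous_on_mult continuous_on_line c k)
  have "B \<ge> 0" using B[of 0] norm_ge_zero order_trans by blast
  thus "AE y in lborel. norm (h (Complex c y) * k (Complex c y)) \<le> norm (B * norm (h (Complex c y)))"
    by (intro AE_I2) (simp add: norm_mult mult.commute[of B] mult_left_mono B)
qed

lemma integrable_kernel:
  assumes c: "0 < c" "c < b" and x: "x > 0"
  shows "vline_integrable c (\<lambda>\<xi>. h \<xi> * of_real x powr (- \<xi>))"
proof (rule integrable_line_mult[OF c])
  show "continuous_on UNIV (\<lambda>y. of_real x powr (- Complex c y))"
    using x unfolding Complex_eq by (intro continuous_intros) auto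
  show "norm (of_real x powr (- Complex c y)) \<le> x powr (-c)" for y
    using x by (simp add: norm_powr_real_powr)
qed

text \<open>The modulus of \<open>x powr (- \<xi>)\<close> is constant along a vertical line, so it
  leaves the integral as a factor.\<close>

lemma norm_mellin_inv_le:
  assumes x: "x > 0"
  shows "norm (mellin_inv c x) \<le> line_norm c * x powr (-c)"
proof -
  have "norm (LBINT y. h (Complex c y) * of_real x powr (- Complex c y)) \<le>
        (LBINT y. norm (h (Complex c y) * of_real x powr (- Complex c y)))"
    by (rule integral_norm_bound)
  also have "\<dots> = (LBINT y. norm (h (Complex c y))) * x powr (-c)"
    using x by (simp add: norm_mult norm_powr_real_powr)
  finally show ?thesis
    by (simp add: mellin_inv_def vline_integral_def line_norm_def norm_mult norm_divide divide_right_mono)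
qed

lemma tendsto_exp_decay: "((\<lambda>R. K * exp (- e * R)) \<longlongrightarrow> 0) at_top"
  using e by real_asymp

text \<open>The integrand is holomorphic between the two lines, so every rectangle integral is zero
  by Cauchy's theorem.\<close>

lemma mellin_inv_eq_aux:
  assumes c: "0 < c1" "c1 < c2" "c2 < b" and x: "x > 0"
  shows "mellin_inv c1 x = mellin_inv c2 x"
proof -
  let ?q = "\<lambda>\<xi>. h \<xi> * of_real x powr (- \<xi>)"
  obtain K where K: "\<And>z. c1 \<le> Re z \<and> Re z \<le> c2 \<Longrightarrow> norm (h z) \<le> K * exp (- e * \<bar>Im z\<bar>)"
    using decay[of c1 c2] c by blast
  \<comment> \<open>\<open>x powr (- Re z)\<close> is largest at \<open>c1\<close> if
    \<open>x \<ge> 1\<close> and at \<open>c2\<close> otherwise; the sum covers both cases.\<close>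
  define B where "B = x powr (-c1) + x powr (-c2)"
  have "vline_integral c2 ?q - vline_integral c1 ?q = 0"
  proof (rule vline_integral_diff[where T = 0 and \<delta> = "\<lambda>R. (K * B) * exp (- e * R)"])
    show "vline_integrable c1 ?q" "vline_integrable c2 ?q"
      using c x by (auto intro!: integrable_kernel)
    show "(?q has_contour_integral 0) (rectpath (Complex c1 (-R)) (Complex c2 R))" if R: "R > 0" for R
    proof (rule Cauchy_theorem_convex_simple)
      show "?q holomorphic_on cbox (Complex c1 (-R)) (Complex c2 R)"
        using c x by (intro holomorphic_intros holomorphic_on_subset[OF hol])
          (auto simp: in_cbox_complex_iff vstrip_def)
      show "path_image (rectpath (Complex c1 (-R)) (Complex c2 R)) \<subseteq> cbox (Complex c1 (-R)) (Complex c2 R)"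
        using c R by (intro path_image_rectpath_subset_cbox) auto
    qed auto
    show "norm (?q z) \<le> (K * B) * exp (- e * \<bar>Im z\<bar>)" if z: "c1 \<le> Re z" "Re z \<le> c2" for z
    proof -
      have "x powr (- Re z) \<le> B"
      proof (cases "x \<ge> 1")
        case True
        hence "x powr (- Re z) \<le> x powr (-c1)" using z by (intro powr_mono) auto
        thus ?thesis by (simp add: B_def add_increasing2)
      next
        case False
        hence "x powr (- Re z) \<le> x powr (-c2)" using z x by (intro powr_mono') auto
        thus ?thesis by (simp add: B_def add_increasing)
      qed
      hence "norm (h z) * x powr (- Re z) \<le> (K * exp (- e * \<bar>Im z\<bar>)) * B"
        using K[of z] z by (intro mult_mono) (auto intro: order_trans[OF norm_ge_zero])
      thus ?thesis using x by (simp add: norm_mult norm_powr_real_powr mult_ac)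
    qed
    show "((\<lambda>R. (K * B) * exp (- e * R)) \<longlongrightarrow> 0) at_top" by (rule tendsto_exp_decay)
  qed (use c in auto)
  thus ?thesis by (simp add: mellin_inv_def)
qed

lemma mellin_inv_eq:
  assumes "0 < c1" "c1 < b" "0 < c2" "c2 < b" "x > 0"
  shows "mellin_inv c1 x = mellin_inv c2 x"
  using mellin_inv_eq_aux[of c1 c2 x] mellin_inv_eq_aux[of c2 c1 x] assms
  by (metis linorder_neqE_linordered_idom)

lemma isCont_mellin_inv:
  assumes c: "0 < c" "c < b" and x: "x > 0"
  shows "isCont (mellin_inv c) x"
proof -
  \<comment> \<open>Staying to the right of \<open>x/2\<close> bounds \<open>t powr (-c)\<close> by
    \<open>(x/2) powr (-c)\<close>, which gives a majorant independent of \<open>t\<close>.\<close>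
  have "((\<lambda>t. LBINT y. h (Complex c y) * of_real t powr (- Complex c y)) \<longlongrightarrow>
         (LBINT y. h (Complex c y) * of_real x powr (- Complex c y))) (at x within {x/2<..})"
    unfolding tendsto_at_iff_sequentially o_def
  proof (intro allI impI)
    fix X :: "nat \<Rightarrow> real"
    assume X: "\<forall>i. X i \<in> {x/2<..} - {x}" and lim: "X \<longlonglongrightarrow> x"
    have X_pos: "X i > 0" "X i \<ge> x/2" for i using X[rule_format, of i] x by auto
    show "(\<lambda>i. LBINT y. h (Complex c y) * of_real (X i) powr (- Complex c y)) \<longlonglongrightarrow>
         (LBINT y. h (Complex c y) * of_real x powr (- Complex c y))"
    proof (rule integral_dominated_convergence[where w = "\<lambda>y. norm (h (Complex c y)) * (x/2) powr (-c)"])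
      show "(\<lambda>y. h (Complex c y) * of_real x powr (- Complex c y)) \<in> borel_measurable lborel"
        "\<And>i. (\<lambda>y. h (Complex c y) * of_real (X i) powr (- Complex c y)) \<in> borel_measurable lborel"
        using integrable_kernel[OF c] x X_pos(1)
        by (auto simp: vline_integrable_def dest: borel_measurable_integrable)
      show "integrable lborel (\<lambda>y. norm (h (Complex c y)) * (x/2) powr (-c))"
        by (intro integrable_mult_left integrable_norm integrable_line c)
      show "AE y in lborel. (\<lambda>i. h (Complex c y) * of_real (X i) powr (- Complex c y))
              \<longlonglongrightarrow> h (Complex c y) * of_real x powr (- Complex c y)"
      proof (intro AE_I2 tendsto_mult tendsto_const)
        fix y
        show "(\<lambda>i. complex_of_real (X i) powr (- Complex c y)) \<longlonglongrightarrow> of_real x powr (- Complex c y)"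
          by (rule isCont_tendsto_compose[OF isCont_of_real_powr[OF x] lim])
      qed
      show "AE y in lborel. norm (h (Complex c y) * of_real (X i) powr (- Complex c y))
              \<le> norm (h (Complex c y)) * (x/2) powr (-c)" for i
      proof (rule AE_I2)
        fix y
        have "X i powr (-c) \<le> (x/2) powr (-c)"
          using X_pos(2)[of i] x c by (intro powr_mono2') auto
        thus "norm (h (Complex c y) * of_real (X i) powr (- Complex c y)) \<le> norm (h (Complex c y)) * (x/2) powr (-c)"
          using X_pos(1)[of i] by (simp add: norm_mult norm_powr_real_powr mult_left_mono)
      qed
    qed
  qed
  moreover have "at x within {x/2<..} = at x"
    using x by (intro at_within_open) auto
  ultimately show ?thesis
    unfolding isCont_def mellin_inv_def vline_integral_def by (auto intro!: tendsto_intros)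
qed

lemma continuous_on_mellin_inv:
  assumes c: "0 < c" "c < b"
  shows "continuous_on {0<..} (mellin_inv c)"
  using isCont_mellin_inv[OF c] by (intro continuous_at_imp_continuous_on) auto

lemma set_integrable_mellin:
  assumes c: "0 < c" "c < b" and A: "A \<subseteq> {0<..}" "A \<in> sets borel"
    and int: "set_integrable lborel A (\<lambda>t. t powr (Re w - c - 1))"
  shows "set_integrable lborel A (\<lambda>t. of_real t powr (w - 1) * mellin_inv c t)"
proof -
  have "set_borel_measurable lborel {0<..} (\<lambda>t. of_real t powr (w - 1) * mellin_inv c t)"
    unfolding set_borel_measurable_def measurable_lborel2
    by (intro borel_measurable_continuous_on_indicator continuous_on_mult continuous_on_mellin_inv c)
       (auto intro!: continuous_intros)
  hence meas: "set_borel_measurable lborel A (\<lambda>t. of_real t powr (w - 1) * mellin_inv c t)"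
    by (rule set_borel_measurable_subset) (use A in auto)
  have "set_integrable lborel A (\<lambda>t. line_norm c * t powr (Re w - c - 1))"
    using int by simp
  thus ?thesis
  proof (rule set_integrable_bound[OF _ meas], intro AE_I2 impI)
    fix t assume "t \<in> A"
    hence t: "t > 0" using A by auto
    have "norm (of_real t powr (w - 1) * mellin_inv c t) \<le> t powr (Re w - 1) * (line_norm c * t powr (-c))"
      using t by (simp add: norm_mult norm_powr_real_powr norm_mellin_inv_le mult_left_mono)
    also have "\<dots> = line_norm c * t powr (Re w - c - 1)"
      by (simp add: algebra_simps flip: powr_add)
    finally show "norm (of_real t powr (w - 1) * mellin_inv c t) \<le> norm (line_norm c * t powr (Re w - c - 1))"
      by (smt (verit) real_norm_def)
  qed
qed

text \<open>Fubini: the modulus of the double integrand is a product of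
  \<open>t powr (Re w - c - 1)\<close> and \<open>norm (h (Complex c y))\<close>, both integrable.
  Taking \<open>A\<close> to be the part of the half-line below or above \<open>1\<close> turns the
  inner integral into a Cauchy kernel.\<close>

lemma set_integral_mellin:
  assumes c: "0 < c" "c < b" and A: "A \<subseteq> {0<..}" "A \<in> sets borel"
    and int: "set_integrable lborel A (\<lambda>t. t powr (Re w - c - 1))"
  shows "(LBINT t:A. of_real t powr (w - 1) * mellin_inv c t) = 1 / (2 * of_real pi) *
     (LBINT y. h (Complex c y) * (LBINT t:A. complex_of_real t powr ((w - Complex c y) - 1)))"
proof -
  define k where "k = (\<lambda>t y. indicat_real A t *\<^sub>R (h (Complex c y) * complex_of_real t powr ((w - Complex c y) - 1)))"
  \<comment> \<open>On \<open>A\<close> all \<open>t\<close> are positive, so the power can be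
    written through the real logarithm; in this form joint measurability follows by
    composition.\<close>
  have k_exp: "case_prod k = (\<lambda>(t, y). indicat_real A t *\<^sub>R (h (Complex c y) * exp (((w - Complex c y) - 1) * of_real (ln t))))"
    using A(1) by (auto simp: k_def fun_eq_iff indicator_def powr_def Ln_of_real subset_iff)
  have [measurable]: "exp \<in> borel_measurable (borel :: complex measure)"
    by (intro borel_measurable_continuous_onI continuous_intros)
  note [measurable] = measurable_line[OF c] A(2)
  have meas: "case_prod k \<in> borel_measurable (lborel \<Otimes>\<^sub>M lborel)"
  proof -
    have "(\<lambda>p. h (Complex c (snd p))) \<in> borel_measurable (lborel \<Otimes>\<^sub>M lborel)"
      by (rule measurable_compose[OF measurable_snd]) simp
    moreover have "(\<lambda>p. ((w - Complex c (snd p)) - 1) * of_real (ln (fst p))) \<in> borel_measurable (lborel \<Otimes>\<^sub>M lborel)"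
      unfolding Complex_eq by measurable
    hence "(\<lambda>p. exp (((w - Complex c (snd p)) - 1) * of_real (ln (fst p)))) \<in> borel_measurable (lborel \<Otimes>\<^sub>M lborel)"
      by (rule measurable_compose) measurable
    ultimately show ?thesis
      unfolding k_exp case_prod_beta by measurable
  qed
  have norm_k: "norm (k t y) = indicat_real A t *\<^sub>R t powr (Re w - c - 1) * norm (h (Complex c y))" for t y
    using A(1) by (auto simp: k_def indicator_def norm_mult norm_powr_real_powr subset_iff)
  have "integrable (lborel \<Otimes>\<^sub>M lborel) (case_prod k)"
  proof (rule lborel_pair.Fubini_integrable[OF meas])
    show "integrable lborel (\<lambda>t. LBINT y. norm (case_prod k (t, y)))"
      using int unfolding set_integrable_def by (simp add: norm_k)
    show "AE t in lborel. integrable lborel (\<lambda>y. case_prod k (t, y))"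
    proof (rule AE_I2)
      fix t :: real
      have "integrable lborel (\<lambda>y. norm (case_prod k (t, y)))"
        unfolding prod.case norm_k by (intro integrable_mult_right integrable_norm integrable_line c)
      moreover have "(\<lambda>y. case_prod k (t, y)) \<in> borel_measurable lborel"
        using meas by measurable
      ultimately show "integrable lborel (\<lambda>y. case_prod k (t, y))"
        using integrable_norm_iff by blast
    qed
  qed
  from lborel_pair.Fubini_integral[OF this]
  have "(LBINT t. LBINT y. k t y) = (LBINT y. LBINT t. k t y)" ..
  also have "(\<lambda>y. LBINT t. k t y) =
      (\<lambda>y. h (Complex c y) * (LBINT t:A. complex_of_real t powr ((w - Complex c y) - 1)))"
    by (simp add: k_def set_lebesgue_integral_def flip: mult_scaleR_right)
  finally have "(LBINT t. LBINT y. k t y) =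
      (LBINT y. h (Complex c y) * (LBINT t:A. complex_of_real t powr ((w - Complex c y) - 1)))" .
  moreover have "(LBINT t:A. of_real t powr (w - 1) * mellin_inv c t) = 
      (LBINT t. 1 / (2 * of_real pi) * (LBINT y. k t y))"
    unfolding set_lebesgue_integral_def
  proof (rule Bochner_Integration.integral_cong[OF refl])
    fix t :: real
    show "indicat_real A t *\<^sub>R (of_real t powr (w - 1) * mellin_inv c t) = 1 / (2 * of_real pi) * (LBINT y. k t y)"
    proof (cases "t \<in> A")
      case True
      have "(\<lambda>y. k t y) = (\<lambda>y. of_real t powr (w - 1) * (h (Complex c y) * of_real t powr (- Complex c y)))"
        using True by (simp add: k_def fun_eq_iff algebra_simps flip: powr_add)
      thus ?thesis
        using True by (simp add: mellin_inv_def vline_integral_def)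
    qed (simp add: k_def)
  qed
  ultimately show ?thesis by simp
qed

text \<open>The Mellin integral is split at \<open>1\<close>; the part near \<open>0\<close> is evaluated with a
  line to the left of \<open>w\<close>, the part near \<open>\<infinity>\<close> with a line to the right, and the two
  resulting Cauchy kernels combine to the residue at \<open>w\<close>.\<close>

lemma mellin_inversion:
  assumes c: "0 < c" "c < b" and w: "0 < Re w" "Re w < b"
  shows "set_integrable lborel {0<..} (\<lambda>t. of_real t powr (w - 1) * mellin_inv c t)"
    and "(LBINT t:{0<..}. of_real t powr (w - 1) * mellin_inv c t) = h w"
proof -
  \<comment> \<open>Any abscissas with \<open>0 < c1 < Re w < c2 < b\<close> work: the first gives
    integrability at \<open>0\<close>, the second at infinity.\<close>
  define c1 c2 where "c1 = Re w / 2" and "c2 = (Re w + b) / 2"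
  have c12: "0 < c1" "c1 < Re w" "Re w < c2" "c2 < b" "c1 < b" "0 < c2"
    using w by (auto simp: c1_def c2_def)
  let ?f = "\<lambda>c t. complex_of_real t powr (w - 1) * mellin_inv c t"
  have powr1: "set_integrable lborel {0<..1} (\<lambda>t. t powr (Re w - c1 - 1))"
    using c12 by (intro set_integrable_powr_from_0) auto
  have powr2: "set_integrable lborel {1<..} (\<lambda>t. t powr (Re w - c2 - 1))"
    using c12 by (intro set_integrable_powr_1_inf) auto
  have f_eq: "?f c t = ?f c' t" if "t > 0" "0 < c'" "c' < b" for t c'
    using mellin_inv_eq[of c c' t] that c by simp
  have cong1: "set_integrable lborel {0<..1} (?f c) = set_integrable lborel {0<..1} (?f c1)"
    using c12 by (intro set_integrable_cong refl f_eq) auto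
  have cong2: "set_integrable lborel {1<..} (?f c) = set_integrable lborel {1<..} (?f c2)"
    using c12 by (intro set_integrable_cong refl f_eq) auto
  have int1: "set_integrable lborel {0<..1} (?f c)"
    unfolding cong1 by (intro set_integrable_mellin powr1) (use c12 in auto)
  have int2: "set_integrable lborel {1<..} (?f c)"
    unfolding cong2 by (intro set_integrable_mellin powr2) (use c12 in auto)
  have Un: "{0::real<..} = {0<..1} \<union> {1<..}" by auto
  show "set_integrable lborel {0<..} (?f c)"
    unfolding Un by (intro set_integrable_Un int1 int2) auto
  let ?q = "\<lambda>\<xi>. h \<xi> / (\<xi> - w)"
  have "(LBINT t:{0<..}. ?f c t) = (LBINT t:{0<..1}. ?f c t) + (LBINT t:{1<..}. ?f c t)"
    unfolding Un by (intro set_integral_Un int1 int2) auto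
  also have "(LBINT t:{0<..1}. ?f c t) = (LBINT t:{0<..1}. ?f c1 t)"
    using c c12 by (intro set_lebesgue_integral_cong) (auto intro!: mellin_inv_eq)
  also have "\<dots> = 1 / (2 * of_real pi) *
     (LBINT y. h (Complex c1 y) * (LBINT t:{0<..1}. complex_of_real t powr ((w - Complex c1 y) - 1)))"
    by (intro set_integral_mellin powr1) (use c12 in auto)
  also have "(\<lambda>y. h (Complex c1 y) * (LBINT t:{0<..1}. complex_of_real t powr ((w - Complex c1 y) - 1))) =
             (\<lambda>y. - ?q (Complex c1 y))"
    using c12 by (subst set_integral_powr_0_1) (auto simp: fun_eq_iff minus_divide_right)
  also have "(LBINT t:{1<..}. ?f c t) = (LBINT t:{1<..}. ?f c2 t)"
    using c c12 by (intro set_lebesgue_integral_cong) (auto intro!: mellin_inv_eq)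
  also have "\<dots> = 1 / (2 * of_real pi) *
     (LBINT y. h (Complex c2 y) * (LBINT t:{1<..}. complex_of_real t powr ((w - Complex c2 y) - 1)))"
    by (intro set_integral_mellin powr2) (use c12 in auto)
  also have "(\<lambda>y. h (Complex c2 y) * (LBINT t:{1<..}. complex_of_real t powr ((w - Complex c2 y) - 1))) =
             (\<lambda>y. ?q (Complex c2 y))"
    using c12 by (subst set_integral_powr_1_inf) (auto simp: fun_eq_iff minus_divide_right)
  \<comment> \<open>The opposite signs of the two kernels leave exactly the difference between the
    right and the left line; the denominator gains the factor \<open>\<i>\<close> contained in
    \<open>vline_integral\<close>.\<close>
  also have "1 / (2 * of_real pi) * (LBINT y. - ?q (Complex c1 y)) + 1 / (2 * of_real pi) * (LBINT y. ?q (Complex c2 y)) =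
     1 / (2 * of_real pi * \<i>) * (vline_integral c2 ?q - vline_integral c1 ?q)"
    unfolding vline_integral_def by (simp add: field_simps)
  also have "vline_integral c2 ?q - vline_integral c1 ?q = 2 * pi * \<i> * h w"
  proof -
    obtain K where K: "\<And>z. c1 \<le> Re z \<and> Re z \<le> c2 \<Longrightarrow> norm (h z) \<le> K * exp (- e * \<bar>Im z\<bar>)"
      using decay[of c1 c2] c12 by blast
    have line: "vline_integrable c' ?q" if c': "0 < c'" "c' < b" "c' \<noteq> Re w" for c'
    proof -
      have "vline_integrable c' (\<lambda>\<xi>. h \<xi> * (1 / (\<xi> - w)))"
      proof (rule integrable_line_mult[OF c'(1,2)])
        have ne: "Complex c' y \<noteq> w" for y using c' by auto
        show "continuous_on UNIV (\<lambda>y. 1 / (Complex c' y - w))"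
          using ne unfolding Complex_eq by (intro continuous_intros) auto
        fix y
        have "\<bar>c' - Re w\<bar> \<le> norm (Complex c' y - w)"
          using abs_Re_le_cmod[of "Complex c' y - w"] by simp
        thus "norm (1 / (Complex c' y - w)) \<le> 1 / \<bar>c' - Re w\<bar>"
          using c' by (simp add: norm_divide frac_le)
      qed
      thus ?thesis by simp
    qed
    show ?thesis
    \<comment> \<open>From this height on, the rectangle encloses \<open>w\<close> and its
      horizontal sides stay at distance at least \<open>1\<close> from \<open>w\<close>, so dividing
      by \<open>\<xi> - w\<close> does not spoil the decay of \<open>h\<close>.\<close>
    proof (rule vline_integral_diff[where T = "\<bar>Im w\<bar> + 1" and \<delta> = "\<lambda>R. K * exp (- e * R)"])
      show "vline_integrable c1 ?q" "vline_integrable c2 ?q"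
        using c12 by (auto intro!: line)
      show "(?q has_contour_integral 2 * pi * \<i> * h w) (rectpath (Complex c1 (-R)) (Complex c2 R))"
        if R: "R > \<bar>Im w\<bar> + 1" for R
      proof -
        let ?S = "cbox (Complex c1 (-R)) (Complex c2 R)"
        have w_box: "w \<in> box (Complex c1 (-R)) (Complex c2 R)"
          using c12 R by (auto simp: in_box_complex_iff)
        have "(?q has_contour_integral (2*pi * \<i> * winding_number (rectpath (Complex c1 (-R)) (Complex c2 R)) w * h w))
                (rectpath (Complex c1 (-R)) (Complex c2 R))"
        proof (rule Cauchy_integral_formula_convex_simple[of ?S])
          show "h holomorphic_on ?S"
            using c12 by (intro holomorphic_on_subset[OF hol]) (auto simp: in_cbox_complex_iff vstrip_def)
          show "w \<in> interior ?S" using w_box by (simp add: interior_cbox)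
          show "path_image (rectpath (Complex c1 (-R)) (Complex c2 R)) \<subseteq> ?S - {w}"
            using c12 R w_box by (subst path_image_rectpath_cbox_minus_box) auto
        qed auto
        thus ?thesis using winding_number_rectpath[OF w_box] by simp
      qed
      show "norm (?q z) \<le> K * exp (- e * \<bar>Im z\<bar>)"
        if z: "c1 \<le> Re z" "Re z \<le> c2" "\<bar>Im z\<bar> > \<bar>Im w\<bar> + 1" for z
      proof -
        have "1 \<le> norm (z - w)"
          using abs_Im_le_cmod[of "z - w"] z by simp
        hence "norm (h z) / norm (z - w) \<le> norm (h z) / 1"
          by (intro divide_left_mono) auto
        thus ?thesis using K[of z] z by (simp add: norm_divide)
      qed
      show "((\<lambda>R. K * exp (- e * R)) \<longlongrightarrow> 0) at_top" by (rule tendsto_exp_decay)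
    qed (use c12 in auto)
  qed
  finally show "(LBINT t:{0<..}. ?f c t) = h w" by simp
qed

end

subsection \<open>The antiderivative and its twisted Mellin transform\<close>

lemma set_integral_powr_from_0:
  assumes "a > (-1::real)" "u \<ge> 0"
  shows "(LBINT t:{0<..u}. t powr a) = u powr (a + 1) / (a + 1)"
proof -
  have "(LBINT t:{0<..u}. t powr a) = integral {0<..u} (\<lambda>t. t powr a)"
    using assms by (intro set_borel_integral_eq_integral set_integrable_powr_from_0)
  also have "\<dots> = integral {0..u} (\<lambda>t. t powr a)"
    by (rule integral_subset_negligible) (auto intro: negligible_subset[of "{0}"])
  also have "\<dots> = u powr (a + 1) / (a + 1)"
    using assms by (intro integral_unique has_integral_powr_from_0)
  finally show ?thesis .
qed

lemma set_integral_norm_bound_le: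
  fixes f :: "real \<Rightarrow> complex"
  assumes "set_integrable lborel A f" "set_integrable lborel A g" "\<And>x. x \<in> A \<Longrightarrow> norm (f x) \<le> g x"
  shows "norm (LBINT x:A. f x) \<le> (LBINT x:A. g x)"
  unfolding set_lebesgue_integral_def
  by (rule Bochner_Integration.integral_norm_bound_integral)
     (use assms in \<open>auto simp: set_integrable_def indicator_def\<close>)

text \<open>Absorbs the powers of \<open>t\<close> that accompany the exponentially small
  contribution of the lower half of the interval.\<close>

lemma exp_minus_half_mult_powr_bounded:
  "\<exists>B. \<forall>t\<ge>1. exp (- t / 2) * t powr a \<le> (B::real)"
proof -
  have "((\<lambda>t::real. exp (- t / 2) * t powr a) \<longlongrightarrow> 0) at_top"
    by real_asymp
  hence "eventually (\<lambda>t::real. exp (- t / 2) * t powr a < 1) at_top"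
    by (rule order_tendstoD) simp
  then obtain T where T: "\<And>t. t \<ge> T \<Longrightarrow> exp (- t / 2) * t powr a < 1"
    by (auto simp: eventually_at_top_linorder)
  have "compact ((\<lambda>t::real. exp (- t / 2) * t powr a) ` {1..T})"
    by (intro compact_continuous_image continuous_intros) auto
  hence "bounded ((\<lambda>t::real. exp (- t / 2) * t powr a) ` {1..T})"
    by (rule compact_imp_bounded)
  then obtain B where B: "\<And>t. t \<in> {1..T} \<Longrightarrow> norm (exp (- t / 2) * t powr a) \<le> B"
    unfolding bounded_iff by blast
  have "exp (- t / 2) * t powr a \<le> max 1 B" if t: "t \<ge> 1" for t
    using T[of t] B[of t] t by (cases "t \<ge> T") auto
  thus ?thesis by blast
qed

context strip_decay
begin

definition mellin_antideriv :: "real \<Rightarrow> real \<Rightarrow> complex" where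
  "mellin_antideriv c t = (LBINT x=0..ereal t. of_real (exp x) * mellin_inv c x)"

text \<open>This is \<open>Gamma z\<close> times the indefinite sum.\<close>

definition sum_integral :: "real \<Rightarrow> complex \<Rightarrow> complex" where
  "sum_integral c z = (LBINT t:{0<..}. of_real (exp (- t)) * of_real t powr (z - 1) * mellin_antideriv c t)"

lemma continuous_on_exp_mellin_inv:
  assumes c: "0 < c" "c < b"
  shows "continuous_on {0<..} (\<lambda>x. of_real (exp x) * mellin_inv c x)"
  by (intro continuous_on_mult continuous_on_mellin_inv c) (auto intro!: continuous_intros)

text \<open>The line through \<open>1/2\<close> lies in the strip because \<open>b > 1\<close>, and
  the resulting bound \<open>x powr (-1/2)\<close> is integrable at \<open>0\<close>. Any abscissa
  strictly between \<open>0\<close> and \<open>1\<close> would serve.\<close>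

lemma set_integrable_exp_mellin_inv:
  assumes b: "b > 1" and c: "0 < c" "c < b" and A: "A \<subseteq> {0<..t}" "A \<in> sets borel" and t: "t > 0"
  shows "set_integrable lborel A (\<lambda>x. of_real (exp x) * mellin_inv c x)"
proof -
  have "set_borel_measurable lborel {0<..} (\<lambda>x. of_real (exp x) * mellin_inv c x)"
    unfolding set_borel_measurable_def measurable_lborel2
    by (intro borel_measurable_continuous_on_indicator continuous_on_exp_mellin_inv c) auto
  hence meas: "set_borel_measurable lborel {0<..t} (\<lambda>x. of_real (exp x) * mellin_inv c x)"
    by (rule set_borel_measurable_subset) auto
  have "set_integrable lborel {0<..t} (\<lambda>x. (exp t * line_norm (1/2)) * x powr (-1/2))"
    using t by (intro set_integrable_mult_right set_integrable_powr_from_0) auto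
  hence "set_integrable lborel {0<..t} (\<lambda>x. of_real (exp x) * mellin_inv c x)"
  proof (rule set_integrable_bound[OF _ meas], intro AE_I2 impI)
    fix x assume x: "x \<in> {0<..t}"
    have "norm (mellin_inv c x) \<le> line_norm (1/2) * x powr (-(1/2))"
      using norm_mellin_inv_le[of x "1/2"] mellin_inv_eq[of c "1/2" x] x b c by simp
    hence "exp x * norm (mellin_inv c x) \<le> exp t * (line_norm (1/2) * x powr (-(1/2)))"
      using x by (intro mult_mono) auto
    thus "norm (of_real (exp x) * mellin_inv c x) \<le> norm ((exp t * line_norm (1/2)) * x powr (-1/2))"
      using line_norm_nonneg[of "1/2"] by (simp add: norm_mult abs_mult mult_ac)
  qed
  thus ?thesis
    by (rule set_integrable_subset) (use A in auto)
qed

lemma mellin_antideriv_Ioc: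
  assumes "t > 0"
  shows "mellin_antideriv c t = (LBINT x:{0<..t}. of_real (exp x) * mellin_inv c x)"
  using assms unfolding mellin_antideriv_def zero_ereal_def
  by (subst interval_integral_Ioc) auto

text \<open>The same line through \<open>1/2\<close>, with \<open>exp x \<le> exp t\<close>; the
  factor \<open>2\<close> comes from integrating \<open>x powr (-1/2)\<close>. The power
  \<open>t powr (1/2)\<close> gives the behaviour near \<open>0\<close>.\<close>

lemma norm_mellin_antideriv_le:
  assumes b: "b > 1" and c: "0 < c" "c < b" and t: "t > 0"
  shows "norm (mellin_antideriv c t) \<le> 2 * line_norm (1/2) * exp t * t powr (1/2)"
proof -
  have "norm (mellin_antideriv c t) \<le> (LBINT x:{0<..t}. (exp t * line_norm (1/2)) * x powr (-1/2))"
    unfolding mellin_antideriv_Ioc[OF t]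
  proof (rule set_integral_norm_bound_le)
    show "set_integrable lborel {0<..t} (\<lambda>x. of_real (exp x) * mellin_inv c x)"
      using t by (intro set_integrable_exp_mellin_inv b c) auto
    show "set_integrable lborel {0<..t} (\<lambda>x. (exp t * line_norm (1/2)) * x powr (-1/2))"
      using t by (intro set_integrable_mult_right set_integrable_powr_from_0) auto
    fix x assume x: "x \<in> {0<..t}"
    have "norm (mellin_inv c x) \<le> line_norm (1/2) * x powr (-(1/2))"
      using norm_mellin_inv_le[of x "1/2"] mellin_inv_eq[of c "1/2" x] x b c by simp
    hence "exp x * norm (mellin_inv c x) \<le> exp t * (line_norm (1/2) * x powr (-(1/2)))"
      using x by (intro mult_mono) auto
    thus "norm (of_real (exp x) * mellin_inv c x) \<le> (exp t * line_norm (1/2)) * x powr (-1/2)"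
      by (simp add: norm_mult mult_ac)
  qed
  also have "\<dots> = 2 * line_norm (1/2) * exp t * t powr (1/2)"
    using t by (simp add: set_integral_powr_from_0)
  finally show ?thesis .
qed

lemma mellin_antideriv_split:
  assumes b: "b > 1" and c: "0 < c" "c < b" and t: "0 < s" "s \<le> t"
  shows "mellin_antideriv c t = mellin_antideriv c s + (LBINT x:{s<..t}. of_real (exp x) * mellin_inv c x)"
proof -
  have "{0<..t} = {0<..s} \<union> {s<..t}" using t by auto
  moreover have "(LBINT x:{0<..s} \<union> {s<..t}. of_real (exp x) * mellin_inv c x) =
      (LBINT x:{0<..s}. of_real (exp x) * mellin_inv c x) + (LBINT x:{s<..t}. of_real (exp x) * mellin_inv c x)"
    using t by (intro set_integral_Un set_integrable_exp_mellin_inv[where t = t] b c) auto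
  ultimately show ?thesis
    using t by (simp add: mellin_antideriv_Ioc)
qed

text \<open>Splitting at \<open>t/2\<close>: on \<open>[t/2, t]\<close> the factor \<open>x\<^sup>-\<^sup>d\<close> has the size of \<open>t\<^sup>-\<^sup>d\<close>, while the
  contribution of \<open>[0, t/2]\<close> is exponentially smaller than \<open>e\<^sup>t\<close>.\<close>

lemma norm_mellin_antideriv_le_at_top:
  assumes b: "b > 1" and c: "0 < c" "c < b" and d: "0 < d" "d < b"
  shows "\<exists>K. \<forall>t\<ge>1. exp (-t) * norm (mellin_antideriv c t) \<le> K * t powr (-d)"
proof -
  \<comment> \<open>The exponent collects \<open>1/2\<close> from the bound on the antiderivative at
    \<open>t/2\<close> and \<open>d\<close> from factoring out \<open>t powr (-d)\<close>.\<close>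
  obtain B where B: "\<And>t. t \<ge> 1 \<Longrightarrow> exp (- t / 2) * t powr (1/2 + d) \<le> B"
    using exp_minus_half_mult_powr_bounded by blast
  have "exp (-t) * norm (mellin_antideriv c t) \<le> (2 * line_norm (1/2) * B + line_norm d * 2 powr d) * t powr (-d)"
    if t: "t \<ge> 1" for t
  proof -
    let ?I = "LBINT x:{t/2<..t}. complex_of_real (exp x) * mellin_inv c x"
    have exp_int: "set_integrable lborel {t/2<..t} exp"
      by (rule set_integrable_subset[OF borel_integrable_atLeastAtMost'[of "t/2" t]])
         (auto intro!: continuous_intros)
    have "(LBINT x=t/2..t. exp x) = exp t - exp (t/2)"
      using t by (intro interval_integral_FTC_finite)
        (auto intro!: continuous_intros derivative_eq_intros simp flip: has_real_derivative_iff_has_vector_derivative)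
    hence exp_eq: "(LBINT x:{t/2<..t}. exp x) = exp t - exp (t/2)"
      using t by (simp add: interval_integral_Ioc)
    have "norm ?I \<le> (LBINT x:{t/2<..t}. (line_norm d * (t/2) powr (-d)) * exp x)"
    proof (rule set_integral_norm_bound_le)
      show "set_integrable lborel {t/2<..t} (\<lambda>x. of_real (exp x) * mellin_inv c x)"
        using t by (intro set_integrable_exp_mellin_inv[where t = t] b c) auto
      show "set_integrable lborel {t/2<..t} (\<lambda>x. (line_norm d * (t/2) powr (-d)) * exp x)"
        using exp_int by simp
      fix x assume x: "x \<in> {t/2<..t}"
      hence "norm (mellin_inv c x) \<le> line_norm d * x powr (-d)"
        using norm_mellin_inv_le[of x d] mellin_inv_eq[of c d x] t c d by simp
      also have "\<dots> \<le> line_norm d * (t/2) powr (-d)"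
        using x t d by (intro mult_left_mono powr_mono2' line_norm_nonneg) auto
      finally show "norm (of_real (exp x) * mellin_inv c x) \<le> (line_norm d * (t/2) powr (-d)) * exp x"
        by (simp add: norm_mult)
    qed
    also have "\<dots> = (line_norm d * (t/2) powr (-d)) * (exp t - exp (t/2))"
      by (simp add: exp_eq)
    also have "\<dots> \<le> (line_norm d * (t/2) powr (-d)) * exp t"
      using line_norm_nonneg[of d] by (intro mult_left_mono) auto
    also have "(t/2) powr (-d) = 2 powr d * t powr (-d)"
      using t by (simp add: powr_divide powr_minus field_simps)
    finally have "norm ?I \<le> line_norm d * (2 powr d * t powr (-d)) * exp t" .
    hence "exp (-t) * norm ?I \<le> exp (-t) * (line_norm d * (2 powr d * t powr (-d)) * exp t)"
      by (intro mult_left_mono) auto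
    also have "\<dots> = line_norm d * 2 powr d * t powr (-d)"
      by (simp add: exp_minus field_simps)
    finally have part2: "exp (-t) * norm ?I \<le> line_norm d * 2 powr d * t powr (-d)" .
    have "norm (mellin_antideriv c (t/2)) \<le> 2 * line_norm (1/2) * exp (t/2) * (t/2) powr (1/2)"
      using t by (intro norm_mellin_antideriv_le b c) auto
    also have "\<dots> \<le> 2 * line_norm (1/2) * exp (t/2) * t powr (1/2)"
      using t line_norm_nonneg[of "1/2"] by (intro mult_left_mono powr_mono2) auto
    finally have "exp (-t) * norm (mellin_antideriv c (t/2)) \<le> exp (-t) * (2 * line_norm (1/2) * exp (t/2) * t powr (1/2))"
      by (intro mult_left_mono) auto
    also have "\<dots> = 2 * line_norm (1/2) * (exp (-t) * exp (t/2)) * t powr (1/2)"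
      by (simp add: mult_ac)
    also have "exp (-t) * exp (t/2) = exp (-t/2)"
      by (simp flip: exp_add)
    also have "t powr (1/2) = t powr (1/2 + d) * t powr (-d)"
      by (simp flip: powr_add)
    also have "2 * line_norm (1/2) * exp (-t/2) * (t powr (1/2 + d) * t powr (-d)) =
               2 * line_norm (1/2) * (exp (-t/2) * t powr (1/2 + d)) * t powr (-d)"
      by (simp only: mult_ac)
    also have "\<dots> \<le> 2 * line_norm (1/2) * B * t powr (-d)"
      using B[OF t] line_norm_nonneg[of "1/2"] by (intro mult_right_mono mult_left_mono) auto
    finally have part1: "exp (-t) * norm (mellin_antideriv c (t/2)) \<le> 2 * line_norm (1/2) * B * t powr (-d)" .
    have "norm (mellin_antideriv c t) \<le> norm (mellin_antideriv c (t/2)) + norm ?I"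
      using mellin_antideriv_split[OF b c, of "t/2" t] t norm_triangle_ineq by simp
    hence "exp (-t) * norm (mellin_antideriv c t) \<le> exp (-t) * (norm (mellin_antideriv c (t/2)) + norm ?I)"
      by (intro mult_left_mono) auto
    also have "\<dots> \<le> 2 * line_norm (1/2) * B * t powr (-d) + line_norm d * 2 powr d * t powr (-d)"
      using part1 part2 by (simp add: distrib_left)
    finally show ?thesis by (simp add: distrib_right)
  qed
  thus ?thesis by blast
qed

lemma has_vector_derivative_mellin_antideriv:
  assumes b: "b > 1" and c: "0 < c" "c < b" and t: "t > 0"
  shows "(mellin_antideriv c has_vector_derivative of_real (exp t) * mellin_inv c t) (at t)"
proof -
  let ?f = "\<lambda>x. complex_of_real (exp x) * mellin_inv c x"
  \<comment> \<open>The integrand may be singular at \<open>0\<close>, so the base point is moved to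
    \<open>t/2\<close>, where the integrand is continuous on a compact interval around
    \<open>t\<close>.\<close>
  have "((\<lambda>u. LBINT x=t/2..u. ?f x) has_vector_derivative ?f t) (at t within {t/2..2*t})"
    using t by (intro interval_integral_FTC2 continuous_on_subset[OF continuous_on_exp_mellin_inv[OF c]]) auto
  moreover have "at t within {t/2..2*t} = at t"
    using t by (intro at_within_interior) auto
  ultimately have "((\<lambda>u. mellin_antideriv c (t/2) + (LBINT x=t/2..u. ?f x)) has_vector_derivative ?f t) (at t)"
    by (auto intro!: derivative_eq_intros)
  thus ?thesis
  proof (rule has_vector_derivative_transform_within_open)
    show "open {t/2<..}" "t \<in> {t/2<..}" using t by auto
    fix u assume u: "u \<in> {t/2<..}"
    thus "mellin_antideriv c (t/2) + (LBINT x=t/2..u. ?f x) = mellin_antideriv c u"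
      using mellin_antideriv_split[OF b c, of "t/2" u] t by (simp add: interval_integral_Ioc)
  qed
qed

lemma isCont_mellin_antideriv:
  assumes "b > 1" "0 < c" "c < b" "t > 0"
  shows "isCont (mellin_antideriv c) t"
  using has_vector_derivative_continuous[OF has_vector_derivative_mellin_antideriv] assms by blast

lemma isCont_sum_integrand:
  assumes "b > 1" "0 < c" "c < b" "t > 0"
  shows "isCont (\<lambda>t. of_real (exp (- t)) * of_real t powr s * mellin_antideriv c t) t"
  using assms by (intro continuous_mult isCont_of_real_powr isCont_mellin_antideriv) (auto intro!: continuous_intros)

lemma sum_integrand_measurable:
  assumes "b > 1" "0 < c" "c < b"
  shows "(\<lambda>t. indicat_real {0<..} t *\<^sub>R (of_real (exp (- t)) * of_real t powr (z - 1) * mellin_antideriv c t)) \<in> borel_measurable borel"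
  using assms
  by (intro borel_measurable_continuous_on_indicator continuous_at_imp_continuous_on ballI isCont_sum_integrand) auto

text \<open>One majorant for a closed substrip: \<open>t powr (Re z - 1)\<close> is largest at
  \<open>Re z = a1\<close> for \<open>t \<le> 1\<close> and at \<open>Re z = a2\<close> for
  \<open>t > 1\<close>. It gives both convergence and holomorphy of the integral.\<close>

lemma sum_integrand_dominated:
  assumes b: "b > 1" and c: "0 < c" "c < b" and a: "0 < a1" "0 < a2" "a2 < b"
  shows "\<exists>D. integrable lborel D \<and> (\<forall>z t. a1 \<le> Re z \<and> Re z \<le> a2 \<longrightarrow>
           norm (indicat_real {0<..} t *\<^sub>R (of_real (exp (- t)) * of_real t powr (z - 1) * mellin_antideriv c t)) \<le> D t)"
proof -
  \<comment> \<open>Strictly between \<open>a2\<close> and \<open>b\<close>, so that the exponent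
    \<open>a2 - d - 1\<close> is below \<open>-1\<close> at infinity.\<close>
  define d where "d = (a2 + b) / 2"
  have d: "0 < d" "d < b" "a2 < d" using a by (auto simp: d_def)
  obtain K where K: "\<And>t. t \<ge> 1 \<Longrightarrow> exp (-t) * norm (mellin_antideriv c t) \<le> K * t powr (-d)"
    using norm_mellin_antideriv_le_at_top[OF b c d(1,2)] by blast
  define N where "N = 2 * line_norm (1/2)"
  define D where "D = (\<lambda>t. indicat_real {0<..1} t *\<^sub>R (N * t powr (a1 - 1/2)) + indicat_real {1<..} t *\<^sub>R (K * t powr (a2 - d - 1)))"
  have "set_integrable lborel {0<..1} (\<lambda>t. N * t powr (a1 - 1/2))"
    using a by (intro set_integrable_mult_right set_integrable_powr_from_0) auto
  moreover have "set_integrable lborel {1<..} (\<lambda>t. K * t powr (a2 - d - 1))"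
    using d by (intro set_integrable_mult_right set_integrable_powr_1_inf) auto
  ultimately have "integrable lborel D"
    unfolding D_def set_integrable_def by (rule Bochner_Integration.integrable_add)
  moreover have "norm (indicat_real {0<..} t *\<^sub>R (of_real (exp (- t)) * of_real t powr (z - 1) * mellin_antideriv c t)) \<le> D t"
    if z: "a1 \<le> Re z" "Re z \<le> a2" for z t
  proof -
    consider "t \<le> 0" | "0 < t" "t \<le> 1" | "t > 1" by linarith
    thus ?thesis
    proof cases
      case 1
      thus ?thesis by (simp add: D_def)
    next
      case 2
      have "norm (mellin_antideriv c t) \<le> N * exp t * t powr (1/2)"
        using norm_mellin_antideriv_le[OF b c, of t] 2 by (simp add: N_def)
      hence "exp (-t) * norm (mellin_antideriv c t) \<le> exp (-t) * (N * exp t * t powr (1/2))"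
        by (intro mult_left_mono) auto
      also have "\<dots> = N * t powr (1/2)" by (simp add: exp_minus field_simps)
      finally have "t powr (Re z - 1) * (exp (-t) * norm (mellin_antideriv c t)) \<le> t powr (a1 - 1) * (N * t powr (1/2))"
        using 2 z by (intro mult_mono[of "t powr (Re z - 1)"] powr_mono') auto
      also have "\<dots> = N * t powr (a1 - 1/2)"
        by (simp add: mult.left_commute flip: powr_add)
      finally show ?thesis
        using 2 by (simp add: D_def norm_mult norm_powr_real_powr mult_ac)
    next
      case 3
      have "t powr (Re z - 1) * (exp (-t) * norm (mellin_antideriv c t)) \<le> t powr (a2 - 1) * (K * t powr (-d))"
        using 3 z K[of t] by (intro mult_mono[of "t powr (Re z - 1)"] powr_mono) auto
      also have "\<dots> = K * t powr (a2 - d - 1)"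
        by (simp add: mult.left_commute algebra_simps flip: powr_add)
      finally show ?thesis
        using 3 by (simp add: D_def norm_mult norm_powr_real_powr mult_ac)
    qed
  qed
  ultimately show ?thesis by blast
qed

lemma set_integrable_sum_integrand:
  assumes b: "b > 1" and c: "0 < c" "c < b" and z: "0 < Re z" "Re z < b"
  shows "set_integrable lborel {0<..} (\<lambda>t. of_real (exp (- t)) * of_real t powr (z - 1) * mellin_antideriv c t)"
proof -
  obtain D where D: "integrable lborel D"
    "\<And>t. norm (indicat_real {0<..} t *\<^sub>R (of_real (exp (- t)) * of_real t powr (z - 1) * mellin_antideriv c t)) \<le> D t"
    using sum_integrand_dominated[OF b c, of "Re z" "Re z"] z by blast
  show ?thesis
    unfolding set_integrable_def
  proof (rule Bochner_Integration.integrable_bound[OF D(1)])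
    show "AE t in lborel. norm (indicat_real {0<..} t *\<^sub>R (of_real (exp (- t)) * of_real t powr (z - 1) * mellin_antideriv c t)) \<le> norm (D t)"
      using D(2) by (intro AE_I2) (metis abs_ge_self order_trans real_norm_def)
  qed (use sum_integrand_measurable[OF b c] in simp)
qed

lemma holomorphic_sum_integral:
  assumes b: "b > 1" and c: "0 < c" "c < b"
  shows "sum_integral c holomorphic_on vstrip b"
  unfolding sum_integral_def set_lebesgue_integral_def
proof (rule holomorphic_on_lebesgue_integral[OF open_vstrip])
  show "(\<lambda>z. indicat_real {0<..} t *\<^sub>R (of_real (exp (- t)) * of_real t powr (z - 1) * mellin_antideriv c t)) holomorphic_on vstrip b" for t
  proof (cases "t > 0")
    case True
    thus ?thesis unfolding scaleR_conv_of_real by (intro holomorphic_intros) auto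
  qed simp
  show "(\<lambda>t. indicat_real {0<..} t *\<^sub>R (of_real (exp (- t)) * of_real t powr (z - 1) * mellin_antideriv c t)) \<in> borel_measurable lborel" for z
    using sum_integrand_measurable[OF b c] by simp
  fix z assume "z \<in> vstrip b"
  hence z: "0 < Re z" "Re z < b" by (auto simp: vstrip_def)
  \<comment> \<open>Half the distance from \<open>z\<close> to the boundary of the strip, so the
    real parts over the disc fill only a closed substrip.\<close>
  define r where "r = min (Re z) (b - Re z) / 2"
  have r: "r > 0" "Re z - r > 0" "Re z + r < b"
    using z by (auto simp: r_def min_def field_simps)
  obtain D where D: "integrable lborel D"
    "\<And>w t. Re z - r \<le> Re w \<and> Re w \<le> Re z + r \<Longrightarrow>
       norm (indicat_real {0<..} t *\<^sub>R (of_real (exp (- t)) * of_real t powr (w - 1) * mellin_antideriv c t)) \<le> D t"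
    using sum_integrand_dominated[OF b c, of "Re z - r" "Re z + r"] r z by (metis add_pos_pos)
  have "Re z - r \<le> Re w \<and> Re w \<le> Re z + r" if "w \<in> ball z r" for w
    using that abs_Re_le_cmod[of "z - w"] by (auto simp: dist_norm abs_le_iff)
  thus "\<exists>r>0. \<exists>D. integrable lborel D \<and> (\<forall>w\<in>ball z r \<inter> vstrip b. \<forall>t\<in>space lborel.
      norm (indicat_real {0<..} t *\<^sub>R (of_real (exp (- t)) * of_real t powr (w - 1) * mellin_antideriv c t)) \<le> D t)"
    using D r by (intro exI[of _ r] exI[of _ D]) auto
qed

text \<open>Integration by parts: the derivative of \<open>P\<close> is integrated over the
  half-line, and its boundary terms vanish, being of order \<open>t powr (Re z + 1/2)\<close> at
  \<open>0\<close> and \<open>t powr (-1)\<close> at infinity.\<close>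

lemma sum_integral_plus1:
  assumes b: "b > 1" and c: "0 < c" "c < b" and z: "0 < Re z" "Re z + 1 < b"
  shows "sum_integral c (z + 1) = z * sum_integral c z + h (z + 1)"
proof -
  let ?E = "\<lambda>t. complex_of_real (exp (- t))"
  let ?F = "mellin_antideriv c"
  define P where "P = (\<lambda>t. ?E t * of_real t powr z * ?F t)"
  \<comment> \<open>The derivative of \<open>P\<close> is \<open>z * u1 - u2 + u3\<close>; the three
    integrals are \<open>sum_integral c z\<close>, \<open>sum_integral c (z + 1)\<close> and, by
    Mellin inversion, \<open>h (z + 1)\<close>.\<close>
  define u1 u2 u3 where "u1 = (\<lambda>t. ?E t * of_real t powr (z - 1) * ?F t)"
    and "u2 = (\<lambda>t. ?E t * of_real t powr z * ?F t)"
    and "u3 = (\<lambda>t. of_real t powr z * mellin_inv c t)"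
  have int1: "set_integrable lborel {0<..} u1"
    unfolding u1_def using z by (intro set_integrable_sum_integrand b c) auto
  have int2: "set_integrable lborel {0<..} u2"
    unfolding u2_def using set_integrable_sum_integrand[OF b c, of "z + 1"] z by simp
  have int3: "set_integrable lborel {0<..} u3"
    unfolding u3_def using mellin_inversion(1)[OF c, of "z + 1"] z by simp
  have val3: "(LBINT t:{0<..}. u3 t) = h (z + 1)"
    unfolding u3_def using mellin_inversion(2)[OF c, of "z + 1"] z by simp
  have norm_P: "norm (P t) = t powr Re z * (exp (-t) * norm (?F t))" if "t > 0" for t
    using that by (simp add: P_def norm_mult norm_powr_real_powr)
  have int_u: "set_integrable lborel {0<..} (\<lambda>t. z * u1 t - u2 t + u3 t)"
    by (intro set_integral_add set_integral_diff set_integrable_mult_right int1 int2 int3)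
  have "(LBINT t=0..\<infinity>. z * u1 t - u2 t + u3 t) = 0 - 0"
  proof (rule interval_integral_FTC_integrable[where F = P])
    fix t :: real assume "0 < ereal t"
    hence t: "t > 0" by simp
    have "(?E has_vector_derivative - ?E t) (at t)"
      by (rule has_vector_derivative_eq_rhs, rule has_vector_derivative_of_real) (auto intro!: derivative_eq_intros)
    from has_vector_derivative_mult[OF has_vector_derivative_mult[OF this has_vector_derivative_of_real_powr[OF t, of z]]
       has_vector_derivative_mellin_antideriv[OF b c t]]
    have "(P has_vector_derivative (?E t * of_real t powr z * (of_real (exp t) * mellin_inv c t) +
            (?E t * (z * of_real t powr (z - 1)) + - ?E t * of_real t powr z) * ?F t)) (at t)"
      unfolding P_def .
    \<comment> \<open>Here the twist pays off: \<open>exp (-t)\<close> cancels the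
      \<open>exp t\<close> in the derivative of the antiderivative, leaving a plain Mellin
      integrand.\<close>
    moreover have "?E t * of_real (exp t) = 1"
      by (simp add: exp_minus flip: of_real_mult)
    hence "?E t * of_real t powr z * (of_real (exp t) * mellin_inv c t) = u3 t"
      unfolding u3_def by (metis (no_types, opaque_lifting) mult.assoc mult.commute mult.left_neutral)
    ultimately show "(P has_vector_derivative (z * u1 t - u2 t + u3 t)) (at t)"
      by (simp add: u1_def u2_def algebra_simps)
    show "isCont (\<lambda>t. z * u1 t - u2 t + u3 t) t"
      unfolding u1_def u2_def u3_def using t c b
      by (intro continuous_add continuous_diff continuous_mult[OF continuous_const] isCont_sum_integrand
            continuous_mult[OF isCont_of_real_powr isCont_mellin_inv])
  next
    show "set_integrable lborel (einterval 0 \<infinity>) (\<lambda>t. z * u1 t - u2 t + u3 t)"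
      using int_u unfolding zero_ereal_def by simp
    show "((P \<circ> real_of_ereal) \<longlongrightarrow> 0) (at_right 0)"
      unfolding zero_ereal_def ereal_tendsto_simps
    proof (rule Lim_null_comparison)
      define N where "N = 2 * line_norm (1/2)"
      show "eventually (\<lambda>t. norm (P t) \<le> N * t powr (Re z + 1/2)) (at_right 0)"
        using eventually_at_right_less[of 0]
      proof eventually_elim
        fix t :: real assume t: "t > 0"
        have "exp (-t) * norm (?F t) \<le> exp (-t) * (N * exp t * t powr (1/2))"
          using norm_mellin_antideriv_le[OF b c t] unfolding N_def by (intro mult_left_mono) auto
        also have "\<dots> = N * t powr (1/2)" by (simp add: exp_minus field_simps)
        finally have "norm (P t) \<le> t powr Re z * (N * t powr (1/2))"
          unfolding norm_P[OF t] by (intro mult_left_mono) auto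
        thus "norm (P t) \<le> N * t powr (Re z + 1/2)"
          by (simp add: powr_add mult_ac)
      qed
      show "((\<lambda>t. N * t powr (Re z + 1/2)) \<longlongrightarrow> 0) (at_right 0)"
        using z by real_asymp
    qed
    show "((P \<circ> real_of_ereal) \<longlongrightarrow> 0) (at_left \<infinity>)"
      unfolding ereal_tendsto_simps
    proof -
      \<comment> \<open>The exponent \<open>Re z + 1\<close> is admissible because
        \<open>z + 1\<close> lies in the strip, and it beats \<open>t powr Re z\<close> by one
        power.\<close>
      obtain K where K: "\<And>t. t \<ge> 1 \<Longrightarrow> exp (-t) * norm (?F t) \<le> K * t powr (-(Re z + 1))"
        using norm_mellin_antideriv_le_at_top[OF b c, of "Re z + 1"] z by auto
      show "(P \<longlongrightarrow> 0) at_top"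
      proof (rule Lim_null_comparison)
        show "eventually (\<lambda>t. norm (P t) \<le> K * t powr (-1)) at_top"
          using eventually_ge_at_top[of 1]
        proof eventually_elim
          fix t :: real assume t: "t \<ge> 1"
          have "norm (P t) \<le> t powr Re z * (K * t powr (-(Re z + 1)))"
            using norm_P[of t] K[OF t] t by (auto intro!: mult_left_mono)
          also have "\<dots> = K * t powr (-1)"
            by (simp add: mult.left_commute flip: powr_add)
          finally show "norm (P t) \<le> K * t powr (-1)" .
        qed
        show "((\<lambda>t. K * t powr (-1)) \<longlongrightarrow> 0) at_top" by real_asymp
      qed
    qed
  qed simp
  hence "0 = (LBINT t:{0<..}. z * u1 t - u2 t + u3 t)"
    by (simp add: interval_lebesgue_integral_0_infty)
  also have "\<dots> = z * (LBINT t:{0<..}. u1 t) - (LBINT t:{0<..}. u2 t) + h (z + 1)"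
    using int1 int2 int3 by (simp add: set_integral_add set_integral_diff val3)
  finally show ?thesis
    by (simp add: sum_integral_def u1_def u2_def algebra_simps)
qed

end

section \<open>The product of \<open>Gamma\<close> and \<open>\<phi>\<close>, and the indefinite
  sum\<close>

text \<open>With \<open>\<theta>\<close> midway between \<open>\<alpha>\<close> and
  \<open>pi / 2\<close>, the decay of \<open>Gamma\<close> at rate \<open>\<theta>\<close> outweighs
  the growth of \<open>\<phi>\<close> at rate \<open>\<alpha>\<close>; the surplus
  \<open>\<theta> - \<alpha>\<close> is the stated rate.\<close>

lemma strip_decay_Gamma_mult:
  fixes \<phi> :: "complex \<Rightarrow> complex"
  assumes hol: "\<phi> holomorphic_on vstrip b"
    and \<alpha>: "0 \<le> \<alpha>" "\<alpha> < pi / 2"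
    and bound: "\<And>z. z \<in> vstrip b \<Longrightarrow> norm (\<phi> z) \<le> C * exp (\<alpha> * \<bar>Im z\<bar>)"
  shows "strip_decay (\<lambda>\<xi>. Gamma \<xi> * \<phi> \<xi>) b ((pi / 2 - \<alpha>) / 2)"
proof
  define \<theta> where "\<theta> = (\<alpha> + pi / 2) / 2"
  have \<theta>: "0 \<le> \<theta>" "\<theta> < pi / 2" using \<alpha> by (auto simp: \<theta>_def)
  have cos_pos: "cos \<theta> > 0" using \<theta> by (intro cos_gt_zero_pi) auto
  show "(pi / 2 - \<alpha>) / 2 > 0" using \<alpha> by simp
  show "(\<lambda>\<xi>. Gamma \<xi> * \<phi> \<xi>) holomorphic_on vstrip b"
    by (intro holomorphic_intros hol) (auto simp: vstrip_def elim!: nonpos_Ints_cases)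
  fix c1 c2 :: real assume c: "0 < c1" "c2 < b"
  \<comment> \<open>The factor in front of the exponential bound for \<open>Gamma\<close> depends on
    \<open>Re z\<close>; compactness of \<open>{c1..c2}\<close>, away from the pole at
    \<open>0\<close>, makes it a constant.\<close>
  have "compact ((\<lambda>x. Gamma x / cos \<theta> powr x) ` {c1..c2})"
    using c cos_pos
    by (intro compact_continuous_image continuous_intros) (auto elim!: nonpos_Ints_cases)
  hence "bounded ((\<lambda>x. Gamma x / cos \<theta> powr x) ` {c1..c2})"
    by (rule compact_imp_bounded)
  then obtain M where M: "\<And>x. x \<in> {c1..c2} \<Longrightarrow> norm (Gamma x / cos \<theta> powr x) \<le> M"
    unfolding bounded_iff by blast
  show "\<exists>K. \<forall>z. c1 \<le> Re z \<and> Re z \<le> c2 \<longrightarrow>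
          norm (Gamma z * \<phi> z) \<le> K * exp (- ((pi / 2 - \<alpha>) / 2) * \<bar>Im z\<bar>)"
  proof (intro exI allI impI)
    fix z assume z: "c1 \<le> Re z \<and> Re z \<le> c2"
    have "norm (Gamma z) \<le> Gamma (Re z) / cos \<theta> powr Re z * exp (- \<theta> * \<bar>Im z\<bar>)"
      using z c \<theta> by (intro norm_Gamma_le_exp) auto
    also have "\<dots> \<le> M * exp (- \<theta> * \<bar>Im z\<bar>)"
      using order_trans[OF abs_ge_self M[unfolded real_norm_def, of "Re z"]] z
      by (intro mult_right_mono) auto
    finally have Gamma_le: "norm (Gamma z) \<le> M * exp (- \<theta> * \<bar>Im z\<bar>)" .
    have "norm (\<phi> z) \<le> C * exp (\<alpha> * \<bar>Im z\<bar>)"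
      using z c by (intro bound) (auto simp: vstrip_def)
    with Gamma_le have "norm (Gamma z * \<phi> z) \<le> (M * exp (- \<theta> * \<bar>Im z\<bar>)) * (C * exp (\<alpha> * \<bar>Im z\<bar>))"
      unfolding norm_mult by (intro mult_mono) (auto intro: order_trans[OF norm_ge_zero])
    also have "\<dots> = (M * C) * (exp (- \<theta> * \<bar>Im z\<bar>) * exp (\<alpha> * \<bar>Im z\<bar>))"
      by (simp only: mult_ac)
    also have "exp (- \<theta> * \<bar>Im z\<bar>) * exp (\<alpha> * \<bar>Im z\<bar>) = exp (- ((pi / 2 - \<alpha>) / 2) * \<bar>Im z\<bar>)"
      unfolding exp_add[symmetric] by (rule arg_cong[of _ _ exp]) (simp add: \<theta>_def field_simps)
    finally show "norm (Gamma z * \<phi> z) \<le> (M * C) * exp (- ((pi / 2 - \<alpha>) / 2) * \<bar>Im z\<bar>)" .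
  qed
qed

theorem theorem2p1:
  fixes b \<alpha> C \<sigma> :: real and \<phi> :: "complex \<Rightarrow> complex"
  assumes "b > 1"
    and "\<phi> holomorphic_on vstrip b"
    and "\<And>y::real. \<exists>L. ((\<lambda>s::real. \<phi> (Complex s y)) \<longlongrightarrow> L) (at_right 0)"
    and "0 \<le> \<alpha>" and "\<alpha> < pi / 2" and "C > 0"
    and "\<And>z. z \<in> vstrip b \<Longrightarrow> norm (\<phi> z) < C * exp (\<alpha> * \<bar>Im z\<bar>)"
    and "0 < \<sigma>" and "\<sigma> < b"
  defines "g \<equiv> (\<lambda>x::real. complex_of_real (exp x) / (2 * complex_of_real pi * \<i>) *
                  vline_integral \<sigma> (\<lambda>\<xi>. Gamma \<xi> * \<phi> \<xi> * complex_of_real x powr (- \<xi>)))"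
  defines "S \<equiv> (\<lambda>z. 1 / Gamma z *
                  (LBINT t:{0<..}. complex_of_real (exp (- t)) * complex_of_real t powr (z - 1) *
                                   (LBINT x=0..t. g x)))"
  shows "(\<forall>x>0. vline_integrable \<sigma> (\<lambda>\<xi>. Gamma \<xi> * \<phi> \<xi> * complex_of_real x powr (- \<xi>))) \<and>
         (\<forall>t>0. interval_lebesgue_integrable lborel 0 (ereal t) g) \<and>
         (\<forall>z\<in>vstrip b. set_integrable lborel {0<..}
            (\<lambda>t. complex_of_real (exp (- t)) * complex_of_real t powr (z - 1) *
                 (LBINT x=0..t. g x))) \<and>
         is_indefinite_sum (vstrip b) \<phi> S \<and>
         (\<forall>z\<in>vstrip b. S z = twisted_mellin (antideriv0 (twisted_mellin_inv \<sigma> \<phi>)) z)"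
proof -
  define e where "e = (pi / 2 - \<alpha>) / 2"
  define h where "h = (\<lambda>\<xi>. Gamma \<xi> * \<phi> \<xi>)"
  interpret strip_decay h b e
    unfolding h_def e_def
    by (rule strip_decay_Gamma_mult[of _ _ _ C]) (use assms(2,4,5,7) in \<open>auto intro: less_imp_le\<close>)
  note b = \<open>b > 1\<close> and \<sigma> = \<open>0 < \<sigma>\<close> \<open>\<sigma> < b\<close>
  have g_eq: "g = (\<lambda>x. of_real (exp x) * mellin_inv \<sigma> x)"
    unfolding g_def mellin_inv_def by (simp add: h_def)
  have F_eq: "(LBINT x=0..ereal t. g x) = mellin_antideriv \<sigma> t" for t
    by (simp add: g_eq mellin_antideriv_def)
  have S_eq: "S z = 1 / Gamma z * sum_integral \<sigma> z" for z
    by (simp only: S_def F_eq sum_integral_def)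
  \<comment> \<open>\<open>Gamma\<close> vanishes only at the nonpositive integers, where it takes
    the default value \<open>0\<close>.\<close>
  have Gamma_nz: "Gamma z \<noteq> 0" if "Re z > 0" for z :: complex
    using that by (auto simp: Gamma_eq_zero_iff elim!: nonpos_Ints_cases)
  show ?thesis
  proof (intro conjI allI ballI impI)
    show "vline_integrable \<sigma> (\<lambda>\<xi>. Gamma \<xi> * \<phi> \<xi> * complex_of_real x powr (- \<xi>))" if "x > 0" for x
      using integrable_kernel[OF \<sigma> that] by (simp add: h_def)
    show "interval_lebesgue_integrable lborel 0 (ereal t) g" if t: "t > 0" for t
      using t unfolding interval_lebesgue_integrable_def zero_ereal_def g_eq
      by (auto intro!: set_integrable_exp_mellin_inv[OF b \<sigma> _ _ t])
    show "set_integrable lborel {0<..}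
            (\<lambda>t. complex_of_real (exp (- t)) * complex_of_real t powr (z - 1) * (LBINT x=0..t. g x))"
      if "z \<in> vstrip b" for z
      unfolding F_eq by (rule set_integrable_sum_integrand[OF b \<sigma>]) (use that in \<open>auto simp: vstrip_def\<close>)
    show "is_indefinite_sum (vstrip b) \<phi> S"
      unfolding is_indefinite_sum_def
    proof (intro conjI allI impI)
      show "S holomorphic_on vstrip b"
        unfolding S_eq[abs_def] using Gamma_nz
        by (intro holomorphic_intros holomorphic_sum_integral[OF b \<sigma>])
           (auto simp: vstrip_def elim!: nonpos_Ints_cases)
      fix z assume z: "z \<in> vstrip b \<and> z + 1 \<in> vstrip b"
      hence z': "0 < Re z" "Re z + 1 < b" by (auto simp: vstrip_def)
      \<comment> \<open>Dividing the recurrence of \<open>sum_integral\<close> by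
        \<open>Gamma (z + 1) = z * Gamma z\<close> turns its first term into \<open>S z\<close> and
        its second into \<open>\<phi> (z + 1)\<close>.\<close>
      have "Gamma (z + 1) = z * Gamma z"
        using z' by (intro Gamma_plus1) (auto elim!: nonpos_Ints_cases)
      moreover have "sum_integral \<sigma> (z + 1) = z * sum_integral \<sigma> z + Gamma (z + 1) * \<phi> (z + 1)"
        unfolding sum_integral_plus1[OF b \<sigma> z'] by (simp add: h_def)
      moreover have "z \<noteq> 0" using z' by auto
      ultimately show "S z + \<phi> (z + 1) = S (z + 1)"
        using Gamma_nz[OF z'(1)] unfolding S_eq by (simp add: field_simps)
    qed (use open_vstrip assms(2) in auto)
    \<comment> \<open>Both sides unfold to the same integral up to the order of the factors in the
      integrand.\<close>
    show "S z = twisted_mellin (antideriv0 (twisted_mellin_inv \<sigma> \<phi>)) z" for z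
      unfolding S_def twisted_mellin_def antideriv0_def twisted_mellin_inv_def g_def
      by (simp only: mult_ac)
  qed
qed

end
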